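(* Let $\{P_m\}_{m=1}^\infty$ be the sequence of quadratic polynomials associated, as described in the context, with a sequence $\{c_k\}_{k=1}^\infty$ of complex numbers with $|c_k|>4$ for all $k$ and a sequence $\{m_k\}_{k=1}^\infty$ of positive integers with $2^{2^{m_k}}\ge 2\sqrt{|c_k|}$ for all $k$. Then: (i) $\mathcal{J}_m$ is uniformly perfect for every $m\ge 0$ if and only if $\{c_k\}_{k=1}^\infty$ is bounded; and (ii) $\mathcal{J}_m$ is pointwise thin and hereditarily non uniformly perfect (HNUP) for every $m\ge 0$ if and only if $\{c_k\}_{k=1}^\infty$ is unbounded.
   Context: Setup. Let $\{c_k\}_{k=1}^\infty$ be complex numbers with $|c_k|>4$ for every $k$, and let $\{m_k\}_{k=1}^\infty$ be positive integers with $2^{2^{m_k}}\ge 2\sqrt{|c_k|}$ for every $k\ge 1$. Put $M_0=0$ and $M_k=\sum_{j=1}^k (m_j+1)$ for $k\ge 1$. Define $P_m(z)=z^2+c_k$ if $m=M_k$ for some $k\ge 1$, and $P_m(z)=z^2$ for all other $m\ge 1$. Compositions. For $0\le m\le n$, $Q_{m,n}=P_n\circ\cdots\circ P_{m+2}\circ P_{m+1}$, with $Q_{m,m}=\mathrm{Id}$. Iterated Fatou and Julia sets. For $m\ge 0$, $\mathcal{F}_m$ is the set of $z\in\widehat{\mathbb{C}}$ such that the family $\{Q_{m,n}\}_{n=m}^\infty$ (viewed as maps $\widehat{\mathbb C}\to\widehat{\mathbb C}$, with the spherical topology) is normal on some neighbourhood of $z$, and $\mathcal{J}_m=\widehat{\mathbb{C}}\setminus\mathcal{F}_m$.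 Annuli. For $z\in\mathbb{C}$ and $0<r<R$ (finite), $\mathrm{A}(z,r,R)=\{w\in\mathbb{C}: r<|w-z|<R\}$. A conformal annulus is a doubly connected domain $A\subset\mathbb{C}$ that can be conformally mapped onto some round annulus $\mathrm{A}(z,r,R)$ with $0<r<R$; its modulus is $\operatorname{mod}A=\log(R/r)$ (well defined, since $R/r$ is determined by $A$). A conformal annulus $A$ separates a set $F\subset\mathbb{C}$ if $F\cap A=\emptyset$ and $F$ intersects both components of $\mathbb{C}\setminus A$. Uniformly perfect. A compact set $F\subset\mathbb{C}$ with two or more points is uniformly perfect if there is a uniform upper bound on the moduli of all conformal annuli which separate $F$. HNUP. A compact set $E\subset\mathbb{C}$ is hereditarily non uniformly perfect (HNUP) if no subset of $E$ is uniformly perfect. Pointwise thin. A set $E\subset\mathbb{C}$ is pointwise thin if for each $z\in E$ there exist $0<r_n<R_n$ ($n\in\mathbb{N}$) with $R_n/r_n\to+\infty$ and $R_n\to 0$ such that each round annulus $\mathrm{A}(z,r_n,R_n)$ separates $E$. *)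

theory Defs
  imports "HOL-Complex_Analysis.Complex_Analysis"
begin

section \<open>The Riemann sphere with the chordal metric\<close>

datatype riemann_sphere = Plane complex | Infty

fun stereographic :: "riemann_sphere \<Rightarrow> complex \<times> real" where
  "stereographic (Plane z) =
     (of_real (2 / (1 + (cmod z)\<^sup>2)) * z, ((cmod z)\<^sup>2 - 1) / ((cmod z)\<^sup>2 + 1))"
| "stereographic Infty = (0, 1)"

lemma inj_stereographic: "inj stereographic"
proof (rule injI)
  have height: "((cmod z)\<^sup>2 - 1) / ((cmod z)\<^sup>2 + 1) = 1 - 2 / (1 + (cmod z)\<^sup>2)" for z
  proof -
    have "(cmod z)\<^sup>2 + 1 > 0" by (simp add: add_nonneg_pos)
    then show ?thesis by (simp add: field_simps)
  qed
  have pos: "2 / (1 + (cmod z)\<^sup>2) > 0" for z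
    by (simp add: add_pos_nonneg)
  fix x y assume eq: "stereographic x = stereographic y"
  show "x = y"
  proof (cases x; cases y)
    fix z w assume xy: "x = Plane z" "y = Plane w"
    have t: "2 / (1 + (cmod z)\<^sup>2) = 2 / (1 + (cmod w)\<^sup>2)"
      using eq by (simp add: xy height)
    moreover have "of_real (2 / (1 + (cmod z)\<^sup>2)) * z = of_real (2 / (1 + (cmod w)\<^sup>2)) * w"
      using eq unfolding xy stereographic.simps by (rule Pair_inject)
    ultimately have "of_real (2 / (1 + (cmod w)\<^sup>2)) * z = of_real (2 / (1 + (cmod w)\<^sup>2)) * w"
      by (simp only:)
    then have "z = w"
      using pos[of w] by (simp only: mult_cancel_left of_real_eq_0_iff) linarith
    then show ?thesis by (simp add: xy)
  next
    fix z assume "x = Plane z" "y = Infty"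
    then show ?thesis using eq height[of z] pos[of z] by simp
  next
    fix w assume "x = Infty" "y = Plane w"
    then show ?thesis using eq height[of w] pos[of w] by simp
  qed simp
qed

instantiation riemann_sphere :: metric_space
begin

definition dist_riemann_sphere :: "riemann_sphere \<Rightarrow> riemann_sphere \<Rightarrow> real" where
  "dist_riemann_sphere x y = dist (stereographic x) (stereographic y)"

definition uniformity_riemann_sphere :: "(riemann_sphere \<times> riemann_sphere) filter" where
  "uniformity_riemann_sphere = (INF e\<in>{0<..}. principal {(x, y). dist x y < e})"

definition open_riemann_sphere :: "riemann_sphere set \<Rightarrow> bool" where
  "open_riemann_sphere U \<longleftrightarrow>
     (\<forall>x\<in>U. eventually (\<lambda>(x', y). x' = x \<longrightarrow> y \<in> U) uniformity)"

instance
proof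
  fix x y z :: riemann_sphere
  show "dist x y = 0 \<longleftrightarrow> x = y"
    by (simp add: dist_riemann_sphere_def inj_eq[OF inj_stereographic])
  show "dist x y \<le> dist x z + dist y z"
    unfolding dist_riemann_sphere_def by (rule dist_triangle2)
qed (simp_all add: uniformity_riemann_sphere_def open_riemann_sphere_def)

end

fun sphere_ext :: "(complex \<Rightarrow> complex) \<Rightarrow> riemann_sphere \<Rightarrow> riemann_sphere" where
  "sphere_ext p (Plane z) = Plane (p z)"
| "sphere_ext p Infty = Infty"

text \<open>A set of points of the sphere is a subset of the plane, and as such has the property.\<close>
definition in_plane :: "(complex set \<Rightarrow> bool) \<Rightarrow> riemann_sphere set \<Rightarrow> bool" where
  "in_plane \<Phi> S \<longleftrightarrow> (\<exists>F. S = Plane ` F \<and> \<Phi> F)"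

section \<open>Non-autonomous iteration\<close>

text \<open>The sequences \<open>c\<close> and \<open>d\<close> (the exponents, written \<open>m\<^sub>k\<close> on paper) are
  indexed from 1; their values at 0 play no role.\<close>

definition block_end :: "(nat \<Rightarrow> nat) \<Rightarrow> nat \<Rightarrow> nat" where
  "block_end d k = (\<Sum>j=1..k. (d j + 1))"

text \<open>The index below is unique, because \<open>block_end d\<close> is strictly increasing.\<close>
definition quad_seq :: "(nat \<Rightarrow> complex) \<Rightarrow> (nat \<Rightarrow> nat) \<Rightarrow> nat \<Rightarrow> complex \<Rightarrow> complex" where
  "quad_seq c d n z =
     (if \<exists>k\<ge>1. n = block_end d k then z\<^sup>2 + c (THE k. k \<ge> 1 \<and> n = block_end d k) else z\<^sup>2)"

text \<open>\<open>P n \<circ> \<dots> \<circ> P (m + 1)\<close>\<close>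
definition compose_range :: "(nat \<Rightarrow> 'a \<Rightarrow> 'a) \<Rightarrow> nat \<Rightarrow> nat \<Rightarrow> 'a \<Rightarrow> 'a" where
  "compose_range P m n = fold P [Suc m..<Suc n]"

text \<open>The limit is a map into the whole sphere, so convergence to \<open>\<infinity>\<close> is included.\<close>
definition normal_on :: "(riemann_sphere \<Rightarrow> riemann_sphere) set \<Rightarrow> riemann_sphere set \<Rightarrow> bool" where
  "normal_on \<F> U \<longleftrightarrow>
     (\<forall>g :: nat \<Rightarrow> riemann_sphere \<Rightarrow> riemann_sphere. range g \<subseteq> \<F> \<longrightarrow>
        (\<exists>s l. strict_mono (s :: nat \<Rightarrow> nat) \<and>
           (\<forall>K. compact K \<and> K \<subseteq> U \<longrightarrow> uniform_limit K (\<lambda>n. g (s n)) l sequentially)))"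

definition iterated_Fatou :: "(nat \<Rightarrow> complex \<Rightarrow> complex) \<Rightarrow> nat \<Rightarrow> riemann_sphere set" where
  "iterated_Fatou P m =
     {z. \<exists>U. open U \<and> z \<in> U \<and> normal_on {sphere_ext (compose_range P m n) | n. m \<le> n} U}"

definition iterated_Julia :: "(nat \<Rightarrow> complex \<Rightarrow> complex) \<Rightarrow> nat \<Rightarrow> riemann_sphere set" where
  "iterated_Julia P m = - iterated_Fatou P m"

section \<open>Annuli, uniform perfectness and thinness\<close>

definition round_annulus :: "complex \<Rightarrow> real \<Rightarrow> real \<Rightarrow> complex set" where
  "round_annulus z r R = {w. r < cmod (w - z) \<and> cmod (w - z) < R}"

definition doubly_connected_domain :: "complex set \<Rightarrow> bool" where
  "doubly_connected_domain A \<longleftrightarrow>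
     open A \<and> connected A \<and> card (components (- Plane ` A)) = 2"

text \<open>\<open>A\<close> is a conformal annulus and \<open>\<mu>\<close> is its modulus. The modulus is determined by
  \<open>A\<close>; being relational, the definition does not presuppose this.\<close>
definition has_modulus :: "complex set \<Rightarrow> real \<Rightarrow> bool" where
  "has_modulus A \<mu> \<longleftrightarrow> doubly_connected_domain A \<and>
     (\<exists>f z r R. 0 < r \<and> r < R \<and> f holomorphic_on A \<and> inj_on f A \<and>
        f ` A = round_annulus z r R \<and> \<mu> = ln (R / r))"

text \<open>The two complementary components are those in the sphere: for an unbounded \<open>A\<close> the
  component containing \<open>\<infinity>\<close> may fall apart into several pieces when \<open>\<infinity>\<close> is removed. In all
  other cases they correspond to the components of the complement in the plane.\<close>
definition separates :: "complex set \<Rightarrow> complex set \<Rightarrow> bool" where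
  "separates A F \<longleftrightarrow> F \<inter> A = {} \<and> (\<forall>C \<in> components (- Plane ` A). Plane ` F \<inter> C \<noteq> {})"

definition uniformly_perfect :: "complex set \<Rightarrow> bool" where
  "uniformly_perfect F \<longleftrightarrow> compact F \<and> (\<exists>x\<in>F. \<exists>y\<in>F. x \<noteq> y) \<and>
     (\<exists>B. \<forall>A \<mu>. has_modulus A \<mu> \<and> separates A F \<longrightarrow> \<mu> \<le> B)"

definition HNUP :: "complex set \<Rightarrow> bool" where
  "HNUP E \<longleftrightarrow> compact E \<and> (\<forall>F\<subseteq>E. \<not> uniformly_perfect F)"

definition pointwise_thin :: "complex set \<Rightarrow> bool" where
  "pointwise_thin E \<longleftrightarrow>
     (\<forall>z\<in>E. \<exists>r R :: nat \<Rightarrow> real.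
        (\<forall>n. 0 < r n \<and> r n < R n \<and> separates (round_annulus z (r n) (R n)) E) \<and>
        filterlim (\<lambda>n. R n / r n) at_top sequentially \<and> R \<longlonglongrightarrow> 0)"

end

theory Submission imports Defs begin

text \<open>
  Composing the maps of one block gives \<open>z ^ N + c\<close> with
  \<open>4 * cmod c \<le> 2 ^ N\<close> and \<open>cmod c > 4\<close>. The first inequality makes
  every point outside the disc of radius 2 escape to infinity, and it makes all preimages of that disc fall into
  it again. The second makes the disc of radius 2 around \<open>- c\<close> avoid 0, so the map has
  \<open>N\<close> univalent inverse branches on the disc of radius 2. The Julia set is the set of points that
  return to this disc at all block ends (\<open>iterated_Julia_eq_survivors\<close>), a Cantor set built from
  the inverse branches. At each level a piece consists of \<open>N\<close> pieces of the next level, arranged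
  around a circle: relative to the radius of the circle, neighbours have distance of order
  \<open>1 / N\<close>, and the diameter of each is of order \<open>1 / (N * cmod c)\<close>. The
  exponents cancel in the comparison of gaps and pieces, and only \<open>cmod c\<close> remains.

  All of this has to be carried back to the start through arbitrarily many inverse branches. Since the branches
  contract, their distortions form a convergent geometric series, and compositions distort relative distances by
  at most a constant factor (\<open>pullback_bilipschitz\<close>).

  If \<open>c\<close> is unbounded, the gaps at blocks with large \<open>c\<close> are round annuli of large
  modulus around every point, so the Julia set is pointwise thin (\<open>survivors_pointwise_thin\<close>); a
  compact pointwise thin set is hereditarily non uniformly perfect (\<open>pointwise_thin_imp_HNUP\<close>).

  If \<open>c\<close> is bounded, the modulus of an arbitrary conformal annulus must be bounded. Schottky's
  theorem shows that an annulus of large modulus leaves on its inner side a part of the Julia set that is tiny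
  compared with its distance from the rest (\<open>modulus_controls_shape\<close>). The pieces around a circle
  are too close to each other for that: a part that contains one of them contains its neighbours, hence the
  whole circle of pieces, and by induction over the levels everything (\<open>no_isolated_part\<close>).

  The two conclusions exclude each other, so both equivalences follow.
\<close>

section \<open>The plane inside the sphere\<close>

lemma continuous_on_stereographic: "continuous_on S stereographic"
  by (auto simp: continuous_on_iff dist_riemann_sphere_def)

lemma inj_Plane: "inj Plane"
  by (simp add: inj_def)

lemma continuous_on_Plane: "continuous_on S Plane"
proof -
  have "1 + (cmod z)\<^sup>2 \<noteq> 0" "(cmod z)\<^sup>2 + 1 \<noteq> 0" for z
    by (smt (verit) zero_le_power2)+
  then have "continuous_on S (\<lambda>z. stereographic (Plane z))"
    unfolding stereographic.simps by (intro continuous_intros) auto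
  then show ?thesis
    by (simp add: continuous_on_iff dist_riemann_sphere_def)
qed

lemma height_Plane: "snd (stereographic (Plane z)) = 1 - 2 / (1 + (cmod z)\<^sup>2)"
proof -
  have "(cmod z)\<^sup>2 + 1 > 0" by (simp add: add_nonneg_pos)
  then show ?thesis by (simp add: field_simps)
qed

text \<open>Stereographic projection is undone by a formula that is continuous away from the north pole. Hence
  open sets of the plane are open in the sphere.\<close>
lemma inverse_stereographic:
  "fst (stereographic (Plane z)) / of_real (1 - snd (stereographic (Plane z))) = z"
proof -
  have "of_real (2 / (1 + (cmod z)\<^sup>2)) \<noteq> (0 :: complex)"
    unfolding of_real_eq_0_iff by (smt (verit) divide_eq_0_iff zero_le_power2)
  then show ?thesis
    unfolding height_Plane by simp
qed

lemma open_image_Plane: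
  assumes "open S"
  shows "open (Plane ` S)"
proof -
  let ?f = "\<lambda>y. fst (stereographic y) / of_real (1 - snd (stereographic y)) :: complex"
  let ?U = "{y. snd (stereographic y) < 1}"
  have cont: "continuous_on X (\<lambda>y. snd (stereographic y))"
             "continuous_on X (\<lambda>y. fst (stereographic y))" for X
    by (intro continuous_intros continuous_on_stereographic)+
  have U: "open ?U"
    by (intro open_Collect_less cont continuous_intros)
  have "continuous_on ?U ?f"
    by (intro continuous_intros cont) auto
  then have "open (?U \<inter> ?f -` S)"
    using continuous_open_preimage[OF _ U assms] by blast
  moreover have "?U \<inter> ?f -` S = Plane ` S"
  proof (intro set_eqI)
    fix y show "y \<in> ?U \<inter> ?f -` S \<longleftrightarrow> y \<in> Plane ` S"
    proof (cases y)
      case (Plane z)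
      moreover have "snd (stereographic (Plane z)) < 1"
        unfolding height_Plane by (simp add: add_pos_nonneg)
      ultimately show ?thesis
        using inverse_stereographic[of z] by (auto simp del: stereographic.simps)
    qed auto
  qed
  ultimately show ?thesis by simp
qed

lemma compact_image_Plane: "compact K \<Longrightarrow> compact (Plane ` K)"
  by (simp add: compact_continuous_image continuous_on_Plane)

lemma dist_Plane_Infty: "dist (Plane z) Infty = 2 / sqrt (1 + (cmod z)\<^sup>2)"
proof -
  define s where "s = 1 + (cmod z)\<^sup>2"
  have s: "s > 0" by (simp add: s_def add_pos_nonneg)
  have "dist (Plane z) Infty =
      sqrt ((cmod (of_real (2 / s) * z))\<^sup>2 + (1 - 2 / s - 1)\<^sup>2)"
    using height_Plane[of z]
    by (simp add: dist_riemann_sphere_def dist_prod_def s_def dist_norm norm_mult norm_divide)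
  also have "(cmod (of_real (2 / s) * z))\<^sup>2 + (1 - 2 / s - 1)\<^sup>2 = (2 / s)\<^sup>2 * ((cmod z)\<^sup>2 + 1)"
    by (simp add: norm_mult power_mult_distrib algebra_simps norm_divide power_divide add_divide_distrib)
  also have "\<dots> = 4 / s"
  proof -
    have "(cmod z)\<^sup>2 + 1 = s" by (simp add: s_def)
    then show ?thesis using s by (simp add: power2_eq_square)
  qed
  finally show ?thesis
    by (simp add: s_def real_sqrt_divide)
qed

lemma dist_Plane_Infty_le:
  assumes "z \<noteq> 0"
  shows "dist (Plane z) Infty \<le> 2 / cmod z"
proof -
  have "cmod z \<le> sqrt (1 + (cmod z)\<^sup>2)" "0 < sqrt (1 + (cmod z)\<^sup>2)"
    by (auto intro!: real_le_rsqrt add_pos_nonneg)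
  then show ?thesis
    unfolding dist_Plane_Infty using assms by (intro divide_left_mono mult_pos_pos) simp_all
qed

lemma open_neighbourhood_Infty: "open (insert Infty (Plane ` (- cball 0 R)))"
proof -
  have "insert Infty (Plane ` (- cball 0 R)) = - (Plane ` cball 0 R)"
  proof (intro set_eqI)
    fix y show "y \<in> insert Infty (Plane ` (- cball 0 R)) \<longleftrightarrow> y \<in> - (Plane ` cball 0 R)"
      by (cases y) auto
  qed
  moreover have "closed (Plane ` cball 0 R)"
    by (intro compact_imp_closed) (simp add: compact_image_Plane)
  ultimately show ?thesis by (simp add: open_Compl)
qed

lemma Infty_in_closure:
  assumes "\<And>B. \<exists>z\<in>S. cmod z \<ge> B"
  shows "Infty \<in> closure (Plane ` S)"
  unfolding closure_approachable
proof (intro allI impI)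
  fix e :: real assume e: "e > 0"
  obtain z where z: "z \<in> S" "cmod z \<ge> 4 / e" using assms by blast
  have "4 / e > 0" using e by simp
  then have "cmod z > 0" using z by linarith
  then have "dist (Plane z) Infty \<le> 2 / cmod z"
    by (intro dist_Plane_Infty_le) auto
  also have "\<dots> < e"
    using z(2) \<open>cmod z > 0\<close> e by (simp add: field_simps)
  finally show "\<exists>y\<in>Plane ` S. dist y Infty < e" using z by blast
qed

section \<open>Round annuli and pointwise thinness\<close>

lemma components_disjoint_closed_Un:
  assumes "connected X" "connected Y" "closed X" "closed Y" "X \<noteq> {}" "Y \<noteq> {}" "X \<inter> Y = {}"
  shows "components (X \<union> Y) = {X, Y}"
proof -
  have sub: "C \<subseteq> X \<or> C \<subseteq> Y" if C: "connected C" "C \<subseteq> X \<union> Y" for C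
  proof -
    have "X \<inter> C = {} \<or> Y \<inter> C = {}"
      by (rule connected_closedD[OF C(1)]) (use C assms in auto)
    with C(2) show ?thesis by blast
  qed
  have "X \<in> components (X \<union> Y)"
    unfolding in_components_maximal
  proof (intro conjI allI impI)
    fix D assume "D \<noteq> {} \<and> X \<subseteq> D \<and> D \<subseteq> X \<union> Y \<and> connected D"
    with sub[of D] assms show "D = X" by blast
  qed (use assms in auto)
  moreover have "Y \<in> components (X \<union> Y)"
    unfolding in_components_maximal
  proof (intro conjI allI impI)
    fix D assume "D \<noteq> {} \<and> Y \<subseteq> D \<and> D \<subseteq> X \<union> Y \<and> connected D"
    with sub[of D] assms show "D = Y" by blast
  qed (use assms in auto)
  moreover have "C = X \<or> C = Y" if C: "C \<in> components (X \<union> Y)" for C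
  proof -
    have "C \<subseteq> X \<or> C \<subseteq> Y" "C \<noteq> {}"
      using sub in_components_connected[OF C] in_components_subset[OF C] in_components_nonempty[OF C] by auto
    moreover have "D = C" if "C \<subseteq> D" "D \<subseteq> X \<union> Y" "connected D" "D \<noteq> {}" for D
      using C that unfolding in_components_maximal by simp
    ultimately show ?thesis
      using assms by (metis Un_upper1 Un_upper2)
  qed
  ultimately show ?thesis by auto
qed

context
  fixes z :: complex and r R :: real
  assumes rR: "0 < r" "r < R"
begin

lemma components_compl_round_annulus:
  "components (- Plane ` round_annulus z r R) =
     {Plane ` cball z r, insert Infty (Plane ` (- ball z R))}"
proof -
  have compl: "- Plane ` round_annulus z r R = Plane ` cball z r \<union> insert Infty (Plane ` (- ball z R))"
  proof (intro set_eqI)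
    fix y
    show "y \<in> - Plane ` round_annulus z r R \<longleftrightarrow> y \<in> Plane ` cball z r \<union> insert Infty (Plane ` (- ball z R))"
    proof (cases y)
      case (Plane w)
      then show ?thesis
        by (simp add: image_iff round_annulus_def dist_norm norm_minus_commute[of z]) linarith
    qed auto
  qed
  have "\<exists>w\<in>- ball z R. cmod w \<ge> B" for B
  proof
    define x where "x = \<bar>R\<bar> + \<bar>B\<bar> + cmod z"
    have x: "x \<ge> R" "x \<ge> B + cmod z" "x \<ge> 0"
      using norm_ge_zero[of z] unfolding x_def by linarith+
    then show "z + of_real x \<in> - ball z R" by (simp add: dist_norm)
    have "cmod (of_real x) \<le> cmod (z + of_real x) + cmod z"
      using norm_triangle_ineq4[of "z + of_real x" z] by simp
    then show "cmod (z + of_real x) \<ge> B" using x by simp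
  qed
  then have "Infty \<in> closure (Plane ` (- ball z R))"
    by (rule Infty_in_closure)
  moreover have "connected (Plane ` (- ball z R))"
    by (intro connected_continuous_image continuous_on_Plane connected_complement_bounded_convex) auto
  ultimately have "connected (insert Infty (Plane ` (- ball z R)))"
    by (meson closure_subset connected_intermediate_closure insert_subset subset_insertI)
  moreover have "insert Infty (Plane ` (- ball z R)) = - Plane ` ball z R"
  proof (intro set_eqI)
    fix y show "y \<in> insert Infty (Plane ` (- ball z R)) \<longleftrightarrow> y \<in> - Plane ` ball z R"
      by (cases y) auto
  qed
  then have "closed (insert Infty (Plane ` (- ball z R)))"
    by (simp add: open_image_Plane closed_Compl)
  moreover have "connected (Plane ` cball z r)"
    by (intro connected_continuous_image continuous_on_Plane) simp
  moreover have "closed (Plane ` cball z r)"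
    by (intro compact_imp_closed) (simp add: compact_image_Plane)
  ultimately show ?thesis
    unfolding compl using rR by (intro components_disjoint_closed_Un) (auto simp: dist_norm)
qed

lemma has_modulus_round_annulus: "has_modulus (round_annulus z r R) (ln (R / r))"
proof -
  have "Infty \<notin> Plane ` cball z r" by auto
  then have "Plane ` cball z r \<noteq> insert Infty (Plane ` (- ball z R))" by blast
  then have "card (components (- Plane ` round_annulus z r R)) = 2"
    unfolding components_compl_round_annulus by simp
  moreover have "connected (round_annulus z r R)"
    unfolding round_annulus_def by (rule connected_annulus) simp
  moreover have "open (round_annulus z r R)"
    unfolding round_annulus_def by (intro open_Collect_conj open_Collect_less continuous_intros)
  ultimately have "doubly_connected_domain (round_annulus z r R)"
    unfolding doubly_connected_domain_def by blast
  then show ?thesis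
    unfolding has_modulus_def using rR
    by (intro conjI exI[of _ "\<lambda>w. w"] exI[of _ z] exI[of _ r] exI[of _ R]) (auto intro: holomorphic_on_ident)
qed

lemma separates_round_annulus_iff:
  "separates (round_annulus z r R) F \<longleftrightarrow>
     (\<forall>w\<in>F. cmod (w - z) \<le> r \<or> R \<le> cmod (w - z)) \<and>
     (\<exists>w\<in>F. cmod (w - z) \<le> r) \<and> (\<exists>w\<in>F. R \<le> cmod (w - z))"
  (is "_ \<longleftrightarrow> ?A \<and> ?B \<and> ?C")
proof -
  have "F \<inter> round_annulus z r R = {} \<longleftrightarrow> ?A"
    by (auto simp: round_annulus_def not_less)
  moreover have "Plane ` F \<inter> Plane ` cball z r \<noteq> {} \<longleftrightarrow> ?B"
    by (auto simp: dist_norm norm_minus_commute)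
  moreover have "Plane ` F \<inter> insert Infty (Plane ` (- ball z R)) \<noteq> {} \<longleftrightarrow> ?C"
    by (auto simp: dist_norm norm_minus_commute not_less)
  ultimately show ?thesis
    unfolding separates_def components_compl_round_annulus by simp
qed

end

text \<open>Let \<open>F\<close> be a subset of a pointwise thin set with at least two points. The thin annuli
  around a point \<open>x\<close> of \<open>F\<close> avoid \<open>F\<close> and surround \<open>x\<close>, and
  they shrink to \<open>x\<close>; so all but finitely many of them also leave a second point of
  \<open>F\<close> outside. They then separate \<open>F\<close>, and their moduli are unbounded.\<close>
lemma pointwise_thin_imp_HNUP:
  assumes "pointwise_thin E" "compact E"
  shows "HNUP E"
  unfolding HNUP_def
proof (intro conjI allI impI notI)
  fix F assume "F \<subseteq> E" and up: "uniformly_perfect F"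
  then obtain x y B where xy: "x \<in> F" "y \<in> F" "x \<noteq> y"
    and B: "\<And>A \<mu>. has_modulus A \<mu> \<Longrightarrow> separates A F \<Longrightarrow> \<mu> \<le> B"
    unfolding uniformly_perfect_def by blast
  have "x \<in> E" using \<open>F \<subseteq> E\<close> xy(1) by blast
  then obtain r R :: "nat \<Rightarrow> real"
    where "\<forall>n. 0 < r n \<and> r n < R n \<and> separates (round_annulus x (r n) (R n)) E"
      and lim: "filterlim (\<lambda>n. R n / r n) at_top sequentially" "R \<longlonglongrightarrow> 0"
    using assms(1) unfolding pointwise_thin_def by blast
  then have rR: "\<And>n. 0 < r n" "\<And>n. r n < R n" "\<And>n. separates (round_annulus x (r n) (R n)) E"
    by blast+
  have "\<forall>\<^sub>F n in sequentially. R n < cmod (y - x)"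
    using lim(2) by (rule order_tendstoD) (use xy in simp)
  moreover have "\<forall>\<^sub>F n in sequentially. R n / r n > exp B"
    using lim(1) by (simp add: filterlim_at_top_dense)
  ultimately obtain n where n: "R n < cmod (y - x)" "exp B < R n / r n"
    using eventually_happens'[OF sequentially_bot, OF eventually_conj] by blast
  have "\<forall>w\<in>F. cmod (w - x) \<le> r n \<or> R n \<le> cmod (w - x)"
    using rR(3)[of n] \<open>F \<subseteq> E\<close> by (auto simp: separates_round_annulus_iff[OF rR(1,2)])
  then have "separates (round_annulus x (r n) (R n)) F"
    unfolding separates_round_annulus_iff[OF rR(1,2)]
    using n(1) xy rR(1)[of n] by (intro conjI bexI[of _ x] bexI[of _ y]) auto
  then have "ln (R n / r n) \<le> B"
    by (rule B[OF has_modulus_round_annulus[OF rR(1,2)]])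
  moreover have "B < ln (R n / r n)"
    using n(2) rR(1,2)[of n] by (smt (verit) divide_pos_pos exp_le_cancel_iff exp_ln)
  ultimately show False by simp
qed (fact assms(2))

section \<open>Annuli of large modulus\<close>

text \<open>The winding number around a closed curve is locally constant off the curve and vanishes near
  infinity, so with the value 0 at \<open>Infty\<close> it is locally constant on the sphere.\<close>
lemma winding_number_connected_sphere:
  assumes \<gamma>: "path \<gamma>" "pathfinish \<gamma> = pathstart \<gamma>"
    and C: "connected C" "C \<inter> Plane ` path_image \<gamma> = {}"
  shows "(\<forall>p. Plane p \<in> C \<longrightarrow> winding_number \<gamma> p = 0) \<or>
         (Infty \<notin> C \<and> (\<forall>p. Plane p \<in> C \<longrightarrow> winding_number \<gamma> p \<noteq> 0))"
proof -
  let ?L = "\<lambda>k. {p. p \<notin> path_image \<gamma> \<and> winding_number \<gamma> p = k}"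
  obtain B1 where B1: "\<And>p. cmod p \<ge> B1 \<Longrightarrow> winding_number \<gamma> p = 0"
    using winding_number_zero_at_infinity[OF \<gamma>] by blast
  obtain B2 where B2: "\<And>p. p \<in> path_image \<gamma> \<Longrightarrow> cmod p \<le> B2"
    using bounded_path_image[OF \<gamma>(1)] unfolding bounded_iff by blast
  define R where "R = max B1 B2"
  define U where "U = Plane ` ?L 0 \<union> insert Infty (Plane ` (- cball 0 R))"
  define V where "V = Plane ` (\<Union>k\<in>-{0}. ?L k)"
  have out: "p \<in> ?L 0" if "p \<in> - cball 0 R" for p
    using that B1[of p] B2[of p] by (auto simp: R_def)
  have "open U"
    unfolding U_def by (intro open_Un open_image_Plane open_winding_number_levelsets \<gamma> open_neighbourhood_Infty)
  moreover have "open V"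
    unfolding V_def by (intro open_image_Plane open_UN ballI open_winding_number_levelsets \<gamma>)
  moreover have "U \<inter> V \<inter> C = {}"
    using out by (auto simp: U_def V_def)
  moreover have "C \<subseteq> U \<union> V"
  proof
    fix y assume "y \<in> C"
    then show "y \<in> U \<union> V"
    proof (cases y)
      case (Plane p)
      with C(2) \<open>y \<in> C\<close> have "p \<notin> path_image \<gamma>" by blast
      then show ?thesis using Plane by (simp add: U_def V_def image_iff)
    qed (simp add: U_def)
  qed
  ultimately have "U \<inter> C = {} \<or> V \<inter> C = {}"
    using connectedD[OF C(1)] by blast
  then show ?thesis
  proof
    assume "U \<inter> C = {}"
    then have "Infty \<notin> C" "\<And>p. Plane p \<in> C \<Longrightarrow> p \<notin> ?L 0"
      by (auto simp: U_def)
    then show ?thesis using C(2) by blast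
  next
    assume "V \<inter> C = {}"
    then have "\<And>p. Plane p \<in> C \<Longrightarrow> p \<notin> ?L k" if "k \<noteq> 0" for k
      using that by (auto simp: V_def)
    then show ?thesis using C(2) by blast
  qed
qed

text \<open>The value of the bound in Schottky's theorem for functions with
  \<open>norm (f 0) \<le> 1\<close> on the disc of radius \<open>1 / 2\<close>.\<close>
definition schottky_bound :: real where
  "schottky_bound = exp (pi * exp (pi * 16))"

text \<open>The bounded complementary component \<open>C\<close> of an annulus of large modulus is small
  compared with its distance from the other component \<open>D\<close>.

  Uniformize the annulus and lift to the strip of half-width \<open>T = \<mu> / 2\<close> by the exponential
  function, which gives a holomorphic map \<open>H\<close> of the strip onto \<open>A\<close>. The core curve
  \<open>\<gamma>\<close> is the image of a vertical segment of length \<open>2 * pi\<close>. It winds around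
  the points of \<open>C\<close> and not around the points of \<open>D\<close>, so it meets the segment from
  \<open>a\<close> to \<open>b\<close>. The function \<open>(H - a) / (b - a)\<close> omits 0 and 1 and
  has modulus at most 1 at a point over this intersection. Schottky's theorem bounds it by a constant on a disc
  of radius comparable to \<open>\<mu>\<close>, and Cauchy's estimate then bounds its derivative by a multiple
  of \<open>1 / \<mu>\<close>. Thus \<open>\<gamma>\<close> lies in a disc of radius
  \<open>O(1 / \<mu>) * cmod (a - b)\<close>; a point around which \<open>\<gamma>\<close> winds lies in
  the same disc. The lower bound 112 makes the disc of the last estimate, of radius
  \<open>\<mu> / 16 \<ge> 7 > 2 * pi\<close>, contain the whole segment.\<close>
lemma modulus_controls_shape:
  assumes mod: "has_modulus A \<mu>" and \<mu>: "\<mu> \<ge> 112"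
  obtains C D where "components (- Plane ` A) = {C, D}"
    "\<And>a a' b. Plane a \<in> C \<Longrightarrow> Plane a' \<in> C \<Longrightarrow> Plane b \<in> D \<Longrightarrow>
       cmod (a - a') \<le> 64 * pi * schottky_bound / \<mu> * cmod (a - b)"
proof -
  obtain f z0 r R where "doubly_connected_domain A" and rR: "0 < r" "r < R"
    and f: "f holomorphic_on A" "inj_on f A" "f ` A = round_annulus z0 r R" "\<mu> = ln (R / r)"
    using mod unfolding has_modulus_def by blast
  then have A: "open A" "connected A" "card (components (- Plane ` A)) = 2"
    unfolding doubly_connected_domain_def by auto
  obtain g where "g holomorphic_on f ` A" and gf: "\<And>z. z \<in> A \<Longrightarrow> g (f z) = z"
    using holomorphic_has_inverse[OF f(1) A(1) f(2)] by metis
  then have g: "g holomorphic_on round_annulus z0 r R"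
    by (simp add: f(3))
  have gA: "g \<zeta> \<in> A" "f (g \<zeta>) = \<zeta>" if "\<zeta> \<in> round_annulus z0 r R" for \<zeta>
    using that gf f(3) by (metis imageE)+
  define T where "T = \<mu> / 2"
  define s where "s = sqrt (r * R)"
  have s: "s > 0" using rR by (simp add: s_def)
  have "exp \<mu> = R / r" using rR f(4) by simp
  then have "exp T * exp T = R / r" by (simp add: T_def exp_add[symmetric])
  then have eT: "exp T = sqrt (R / r)"
    by (metis exp_ge_zero real_sqrt_mult_self real_sqrt_unique power2_eq_square)
  have sT: "s * exp T = R" "s * exp (- T) = r"
    using rR by (simp_all add: s_def eT exp_minus real_sqrt_mult real_sqrt_divide divide_simps)
  define E where "E = (\<lambda>w. z0 + of_real s * exp w)"
  have E: "E w \<in> round_annulus z0 r R" if "\<bar>Re w\<bar> < T" for w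
  proof -
    have n: "cmod (E w - z0) = s * exp (Re w)"
      using s by (simp add: E_def norm_mult)
    have "s * exp (- T) < s * exp (Re w)" "s * exp (Re w) < s * exp T"
      using that s by auto
    then show ?thesis
      unfolding round_annulus_def mem_Collect_eq n sT by simp
  qed
  define H where "H = g \<circ> E"
  have holH: "H holomorphic_on S" if "\<And>w. w \<in> S \<Longrightarrow> \<bar>Re w\<bar> < T" for S
  proof -
    have "E holomorphic_on S" unfolding E_def by (intro holomorphic_intros)
    moreover have "E ` S \<subseteq> round_annulus z0 r R" using that E by blast
    ultimately show ?thesis
      unfolding H_def using holomorphic_on_compose_gen[OF _ g] by blast
  qed
  have T: "T \<ge> 56" using \<mu> by (simp add: T_def)
  define \<gamma> where "\<gamma> = g \<circ> circlepath z0 s"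
  have circ: "circlepath z0 s t = E (2 * pi * \<i> * t)" for t
    by (simp add: circlepath E_def)
  have circ_in: "circlepath z0 s t \<in> round_annulus z0 r R" for t
    unfolding circ by (rule E) (use T in simp)
  have op: "open (round_annulus z0 r R)"
    unfolding round_annulus_def by (intro open_Collect_conj open_Collect_less continuous_intros)
  have img: "path_image (circlepath z0 s) \<subseteq> round_annulus z0 r R"
    using circ_in by (auto simp: path_image_def)
  have vp: "valid_path \<gamma>"
    unfolding \<gamma>_def by (rule valid_path_compose_holomorphic[OF _ g op img]) simp
  then have path: "path \<gamma>" by (rule valid_path_imp_path)
  have loop: "pathfinish \<gamma> = pathstart \<gamma>"
    unfolding \<gamma>_def by (simp add: pathfinish_compose pathstart_compose)
  have \<gamma>A: "path_image \<gamma> \<subseteq> A"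
    unfolding \<gamma>_def path_image_compose using img gA by blast
  have \<gamma>H: "\<gamma> t = H (2 * pi * \<i> * t)" for t
    by (simp add: \<gamma>_def H_def circ)

  \<comment> \<open>If \<open>\<gamma>\<close> wound around no point outside \<open>A\<close>, Cauchy's theorem would make the integral of
      \<open>f' / (f - z0)\<close> along \<open>\<gamma>\<close> vanish; but \<open>f\<close> maps \<open>\<gamma>\<close> to a circle around \<open>z0\<close>.\<close>
  have nonzero: "\<exists>p. p \<notin> A \<and> winding_number \<gamma> p \<noteq> 0"
  proof (rule ccontr)
    assume "\<not> ?thesis"
    then have zero: "\<And>p. p \<notin> A \<Longrightarrow> winding_number \<gamma> p = 0" by blast
    have ne: "f w \<noteq> z0" if "w \<in> A" for w
    proof -
      have "f w \<in> round_annulus z0 r R" using f(3) that by blast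
      then show ?thesis using rR by (auto simp: round_annulus_def)
    qed
    have "(\<lambda>w. deriv f w * (1 / (f w - z0))) holomorphic_on A"
      by (intro holomorphic_intros holomorphic_deriv f(1) A(1)) (use ne in auto)
    then have "((\<lambda>w. deriv f w * (1 / (f w - z0))) has_contour_integral 0) \<gamma>"
      using Cauchy_theorem_global[OF A(1) _ vp loop \<gamma>A zero] by blast
    then have "contour_integral \<gamma> (\<lambda>w. deriv f w * (1 / (f w - z0))) = 0"
      by (rule contour_integral_unique)
    moreover have "contour_integral (f \<circ> \<gamma>) (\<lambda>w. 1 / (w - z0)) =
        contour_integral \<gamma> (\<lambda>w. deriv f w * (1 / (f w - z0)))"
      by (rule contour_integral_comp_analyticW[OF _ vp \<gamma>A]) (simp add: analytic_on_open A(1) f(1))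
    moreover have "f \<circ> \<gamma> = circlepath z0 s"
      by (rule ext) (simp add: \<gamma>_def gA(2)[OF circ_in])
    moreover have "contour_integral (circlepath z0 s) (\<lambda>w. 1 / (w - z0)) = 2 * of_real pi * \<i>"
      using contour_integral_circlepath[OF s] by simp
    ultimately show False by simp
  qed

  obtain X Y where XY: "components (- Plane ` A) = {X, Y}" "X \<noteq> Y"
    using A(3) by (auto simp: card_2_iff)
  have union: "- Plane ` A = X \<union> Y"
    using Union_components[of "- Plane ` A"] XY by simp
  have sph: "(\<forall>p. Plane p \<in> Z \<longrightarrow> winding_number \<gamma> p = 0) \<or>
         (Infty \<notin> Z \<and> (\<forall>p. Plane p \<in> Z \<longrightarrow> winding_number \<gamma> p \<noteq> 0))"
    if "Z \<in> {X, Y}" for Z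
  proof (rule winding_number_connected_sphere[OF path loop])
    have Z: "Z \<in> components (- Plane ` A)" using that XY by simp
    then show "connected Z" by (rule in_components_connected)
    show "Z \<inter> Plane ` path_image \<gamma> = {}"
      using in_components_subset[OF Z] \<gamma>A by blast
  qed
  have "\<exists>C D. {C, D} = {X, Y} \<and> Infty \<in> D"
  proof -
    have "Infty \<in> X \<union> Y" unfolding union[symmetric] by auto
    then show ?thesis by (metis UnE insert_commute)
  qed
  then obtain C D where CD: "{C, D} = {X, Y}" and inf: "Infty \<in> D" by blast
  have CDXY: "C \<union> D = X \<union> Y" using CD by (auto simp: doubleton_eq_iff)
  have D0: "winding_number \<gamma> p = 0" if "Plane p \<in> D" for p
    using sph[of D] CD inf that by blast
  have C1: "winding_number \<gamma> p \<noteq> 0" if "Plane p \<in> C" for p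
  proof -
    obtain q where q: "q \<notin> A" "winding_number \<gamma> q \<noteq> 0" using nonzero by blast
    have "Plane q \<in> - Plane ` A" using q(1) by auto
    then have "Plane q \<in> C \<union> D" unfolding CDXY union[symmetric] .
    then have "Plane q \<in> C" using D0 q(2) by blast
    then show ?thesis using sph[of C] CD q(2) that by blast
  qed
  have comp: "components (- Plane ` A) = {C, D}" using XY CD by simp
  have notA: "p \<notin> A" if "Plane p \<in> C \<union> D" for p
  proof -
    have "Plane p \<in> X \<union> Y" using that CDXY by simp
    then show ?thesis unfolding union[symmetric] by blast
  qed

  have "cmod (a - a') \<le> 64 * pi * schottky_bound / \<mu> * cmod (a - b)"
    if a: "Plane a \<in> C" "Plane a' \<in> C" and b: "Plane b \<in> D" for a a' b
  proof -
    have aA: "a \<notin> A" "a' \<notin> A" "b \<notin> A" using notA a b by blast+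
    have ab: "a \<noteq> b" using C1[OF a(1)] D0[OF b] by metis
    define \<delta> where "\<delta> = cmod (b - a)"
    have \<delta>: "\<delta> > 0" using ab by (simp add: \<delta>_def)
    have "\<not> closed_segment a b \<inter> path_image \<gamma> = {}"
    proof
      assume "closed_segment a b \<inter> path_image \<gamma> = {}"
      then have "winding_number \<gamma> a = winding_number \<gamma> b"
        by (intro winding_number_eq[OF path loop _ _ connected_segment]) auto
      with C1[OF a(1)] D0[OF b] show False by metis
    qed
    then obtain t0 where t0: "t0 \<in> {0..1}" "\<gamma> t0 \<in> closed_segment a b"
      unfolding path_image_def by blast
    then have near: "cmod (\<gamma> t0 - a) \<le> \<delta>"
      using segment_bound1 by (simp add: \<delta>_def)
    define w0 where "w0 = 2 * pi * \<i> * of_real t0"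
    have w0: "Re w0 = 0" "H w0 = \<gamma> t0" by (simp_all add: w0_def \<gamma>H)
    define T' where "T' = T / 2"
    have T': "T' \<ge> 28" "T' < T" using T by (simp_all add: T'_def)
    have inT: "\<bar>Re w\<bar> < T" if "cmod (w - w0) \<le> T'" for w
      using abs_Re_le_cmod[of "w - w0"] w0(1) that T' by simp
    have bound: "cmod (H w - a) \<le> schottky_bound * \<delta>" if w: "cmod (w - w0) \<le> T' / 2" for w
    proof -
      define F where "F = (\<lambda>\<zeta>. (H (w0 + of_real T' * \<zeta>) - a) / (b - a))"
      have arg: "\<bar>Re (w0 + of_real T' * \<zeta>)\<bar> < T" if "\<zeta> \<in> cball 0 1" for \<zeta>
        by (rule inT) (use that T' in \<open>simp add: norm_mult mult_left_le\<close>)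
      have "(H \<circ> (\<lambda>\<zeta>. w0 + of_real T' * \<zeta>)) holomorphic_on cball 0 1"
        by (rule holomorphic_on_compose[OF _ holH]) (use arg in \<open>auto intro!: holomorphic_intros\<close>)
      then have holF: "F holomorphic_on cball 0 1"
        unfolding F_def o_def by (intro holomorphic_intros) (use ab in auto)
      have "H (w0 + of_real T' * \<zeta>) \<in> A" if "\<zeta> \<in> cball 0 1" for \<zeta>
        using gA(1)[OF E[OF arg[OF that]]] by (simp add: H_def)
      then have not01: "\<not> (F \<zeta> = 0 \<or> F \<zeta> = 1)" if "\<zeta> \<in> cball 0 1" for \<zeta>
        using aA ab that by (auto simp: F_def divide_simps)
      have F0: "cmod (F 0) \<le> 1"
        using near \<delta> by (simp add: F_def w0 norm_divide \<delta>_def)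
      define \<zeta> where "\<zeta> = (w - w0) / of_real T'"
      have \<zeta>: "cmod \<zeta> \<le> 1 / 2" "w0 + of_real T' * \<zeta> = w"
        using w T' by (simp_all add: \<zeta>_def norm_divide field_simps)
      have "cmod (F \<zeta>) \<le> exp (pi * exp (pi * (2 + 2 * 1 + 12 * (1/2) / (1 - 1/2))))"
        by (rule Schottky[OF holF F0 not01 _ _ \<zeta>(1)]) auto
      then have "cmod (F \<zeta>) \<le> schottky_bound"
        by (simp add: schottky_bound_def)
      then show ?thesis
        using \<delta> unfolding F_def \<zeta>(2) norm_divide \<delta>_def by (simp add: divide_simps)
    qed
    have der: "cmod (deriv H w) \<le> 4 * schottky_bound * \<delta> / T'" if w: "cmod (w - w0) \<le> T' / 4" for w
    proof -
      have sub: "cmod (x - w0) \<le> T' / 2" if "cmod (w - x) \<le> T' / 4" for x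
        using norm_triangle_ineq[of "x - w" "w - w0"] w that by (simp add: norm_minus_commute)
      have hol: "(\<lambda>w. H w - a) holomorphic_on cball w (T' / 4)"
      proof (intro holomorphic_intros holH inT)
        fix x assume "x \<in> cball w (T' / 4)"
        then show "cmod (x - w0) \<le> T'" using sub[of x] T' by (simp add: dist_norm)
      qed
      have "cmod ((deriv ^^ 1) (\<lambda>w. H w - a) w) \<le> fact 1 * (schottky_bound * \<delta>) / (T' / 4) ^ 1"
        by (rule Cauchy_inequality)
           (use hol T' bound sub in \<open>auto intro: holomorphic_on_subset holomorphic_on_imp_continuous_on\<close>)
      moreover have "deriv (\<lambda>w. H w - a) w = deriv H w"
      proof -
        have "open {w. \<bar>Re w\<bar> < T}"
          by (intro open_Collect_less continuous_intros)
        moreover have "w \<in> {w. \<bar>Re w\<bar> < T}" using inT[of w] w T' by simp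
        ultimately have "H field_differentiable at w"
          using holH[of "{w. \<bar>Re w\<bar> < T}"] by (auto intro: holomorphic_on_imp_differentiable_at)
        then show ?thesis by (simp add: deriv_diff)
      qed
      ultimately show ?thesis by (simp add: mult_ac)
    qed
    define \<rho> where "\<rho> = 8 * pi * schottky_bound * \<delta> / T'"
    have "\<gamma> t \<in> cball (\<gamma> t0) \<rho>" if t: "t \<in> {0..1}" for t
    proof -
      define w where "w = 2 * pi * \<i> * of_real t"
      have "w - w0 = 2 * pi * \<i> * of_real (t - t0)"
        by (simp add: w_def w0_def algebra_simps)
      then have wd: "cmod (w - w0) = 2 * pi * \<bar>t - t0\<bar>" by (simp only: norm_mult norm_of_real) simp
      also have "\<dots> \<le> 2 * pi" using t t0(1) by (auto simp: mult_left_le)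
      finally have d: "cmod (w - w0) \<le> 2 * pi" .
      moreover have "2 * pi \<le> T' / 4" using T' pi_less_4 pi_approx by simp
      ultimately have in4: "w \<in> cball w0 (T' / 4)" "w0 \<in> cball w0 (T' / 4)"
        using T' by (auto simp: dist_norm norm_minus_commute)
      have "cmod (H w - H w0) \<le> (4 * schottky_bound * \<delta> / T') * cmod (w - w0)"
      proof (rule field_differentiable_bound[OF convex_cball _ _ in4])
        fix x assume x: "x \<in> cball w0 (T' / 4)"
        then have x': "cmod (x - w0) \<le> T' / 4" by (simp add: dist_norm norm_minus_commute)
        have "open {w. \<bar>Re w\<bar> < T}"
          by (intro open_Collect_less continuous_intros)
        moreover have "x \<in> {w. \<bar>Re w\<bar> < T}" using inT[of x] x' T' by simp
        ultimately have "H field_differentiable at x"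
          using holH[of "{w. \<bar>Re w\<bar> < T}"] by (auto intro: holomorphic_on_imp_differentiable_at)
        then show "(H has_field_derivative deriv H x) (at x within cball w0 (T' / 4))"
          by (simp add: field_differentiable_derivI has_field_derivative_at_within)
        show "cmod (deriv H x) \<le> 4 * schottky_bound * \<delta> / T'" by (rule der[OF x'])
      qed
      also have "\<dots> \<le> (4 * schottky_bound * \<delta> / T') * (2 * pi)"
        using d \<delta> T' by (intro mult_left_mono) (auto simp: schottky_bound_def)
      also have "\<dots> = \<rho>" by (simp add: \<rho>_def)
      finally show ?thesis
        using w0(2) by (simp add: w_def \<gamma>H dist_norm norm_minus_commute)
    qed
    then have "path_image \<gamma> \<subseteq> cball (\<gamma> t0) \<rho>"
      by (auto simp: path_image_def)
    then have in\<rho>: "p \<in> cball (\<gamma> t0) \<rho>" if "Plane p \<in> C" for p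
      using winding_number_zero_outside[OF path convex_cball loop] C1[OF that] by blast
    have "cmod (a - a') \<le> dist a (\<gamma> t0) + dist a' (\<gamma> t0)"
      unfolding dist_norm[symmetric] by (rule dist_triangle2)
    also have "\<dots> \<le> 2 * \<rho>"
      using in\<rho>[OF a(1)] in\<rho>[OF a(2)] by (simp add: dist_commute)
    also have "\<dots> = 64 * pi * schottky_bound / \<mu> * cmod (a - b)"
      by (simp add: \<rho>_def T'_def T_def \<delta>_def norm_minus_commute)
    finally show ?thesis .
  qed
  with that comp show ?thesis by blast
qed

text \<open>An annulus that separates \<open>F\<close> cuts it into two closed parts, and a large modulus makes
  one part \<open>X\<close> much smaller than its distance from the other part. So it is enough to exclude such
  a well isolated part \<open>X\<close> for one constant \<open>\<kappa>\<close>.\<close>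
lemma uniformly_perfect_criterion:
  assumes F: "compact F" "\<exists>x\<in>F. \<exists>y\<in>F. x \<noteq> y"
    and \<kappa>: "\<kappa> > 0"
    and iso: "\<And>X Y. closed X \<Longrightarrow> closed Y \<Longrightarrow> X \<union> Y = F \<Longrightarrow> X \<inter> Y = {} \<Longrightarrow> X \<noteq> {} \<Longrightarrow> Y \<noteq> {} \<Longrightarrow>
      (\<And>x x' y. x \<in> X \<Longrightarrow> x' \<in> X \<Longrightarrow> y \<in> Y \<Longrightarrow> cmod (x - x') \<le> \<kappa> * cmod (x - y)) \<Longrightarrow> False"
  shows "uniformly_perfect F"
  unfolding uniformly_perfect_def
proof (intro conjI F exI allI impI)
  define B where "B = max 112 (64 * pi * schottky_bound / \<kappa>)"
  fix A \<mu> assume "has_modulus A \<mu> \<and> separates A F"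
  then have A: "has_modulus A \<mu>" "separates A F" by blast+
  show "\<mu> \<le> B"
  proof (rule ccontr)
    assume "\<not> \<mu> \<le> B"
    then have \<mu>: "\<mu> \<ge> 112" "64 * pi * schottky_bound / \<kappa> \<le> \<mu>" by (auto simp: B_def)
    obtain C D where comp: "components (- Plane ` A) = {C, D}"
      and sh: "\<And>a a' b. Plane a \<in> C \<Longrightarrow> Plane a' \<in> C \<Longrightarrow> Plane b \<in> D \<Longrightarrow>
       cmod (a - a') \<le> 64 * pi * schottky_bound / \<mu> * cmod (a - b)"
      using modulus_controls_shape[OF A(1) \<mu>(1)] by blast
    have dc: "doubly_connected_domain A" using A(1) by (simp add: has_modulus_def)
    then have "C \<noteq> D" "closed (- Plane ` A)"
      using comp by (auto simp: doubly_connected_domain_def open_image_Plane closed_Compl)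
    then have disj: "C \<inter> D = {}" and cl: "closed C" "closed D"
      using components_nonoverlap[of C "- Plane ` A" D] comp closed_components[of "- Plane ` A"] by auto
    have ne: "Plane ` F \<inter> C \<noteq> {}" "Plane ` F \<inter> D \<noteq> {}" "F \<inter> A = {}"
      using A(2) comp by (auto simp: separates_def)
    have union: "- Plane ` A = C \<union> D"
      using Union_components[of "- Plane ` A"] comp by simp
    have clo: "closed (F \<inter> Plane -` S)" if "closed S" for S
    proof -
      have "closed (Plane -` S)"
        using that continuous_on_Plane[of UNIV] by (simp add: continuous_on_closed_vimage)
      then show ?thesis using F(1) by (simp add: closed_Int compact_imp_closed)
    qed
    show False
    proof (rule iso[of "F \<inter> Plane -` C" "F \<inter> Plane -` D"])
      show "F \<inter> Plane -` C \<union> F \<inter> Plane -` D = F"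
      proof -
        have "Plane p \<in> C \<union> D" if "p \<in> F" for p
          unfolding union[symmetric] using ne(3) that by auto
        then show ?thesis by blast
      qed
      fix x x' y assume "x \<in> F \<inter> Plane -` C" "x' \<in> F \<inter> Plane -` C" "y \<in> F \<inter> Plane -` D"
      then have "cmod (x - x') \<le> 64 * pi * schottky_bound / \<mu> * cmod (x - y)"
        by (intro sh) auto
      also have "\<dots> \<le> \<kappa> * cmod (x - y)"
        using \<mu> \<kappa> by (intro mult_right_mono) (simp_all add: field_simps)
      finally show "cmod (x - x') \<le> \<kappa> * cmod (x - y)" .
    qed (use disj ne clo cl in auto)
  qed
qed

section \<open>Points that survive a sequence of maps \<open>z ^ N + c\<close>\<close>

text \<open>One map \<open>z ^ N j + c j\<close> stands for a whole block: a run of squarings followed by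
  \<open>z\<^sup>2 + c j\<close>. The iteration may start inside a block, so the first exponent is only known
  to be even and positive, and the bound on \<open>c j\<close> by the exponent is available from the second
  block on.\<close>
locale block_maps =
  fixes N :: "nat \<Rightarrow> nat" and c :: "nat \<Rightarrow> complex"
  assumes N_even: "even (N j)" and N_pos: "0 < N j"
    and c_large: "cmod (c j) > 4"
    and c_small: "j \<ge> 1 \<Longrightarrow> 4 * cmod (c j) \<le> 2 ^ N j"
begin

definition step :: "nat \<Rightarrow> complex \<Rightarrow> complex" where
  "step j z = z ^ N j + c j"

primrec orbit :: "nat \<Rightarrow> nat \<Rightarrow> complex \<Rightarrow> complex" where
  "orbit n 0 z = z"
| "orbit n (Suc j) z = step (n + j) (orbit n j z)"

text \<open>The points whose images at all later block ends lie in the disc of radius 2. For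
  \<open>n = 0\<close> this is the Julia set; the other indices give the Julia sets at the ends of the later
  blocks.\<close>
definition survivors :: "nat \<Rightarrow> complex set" where
  "survivors n = {z. \<forall>j. cmod (orbit n (Suc j) z) \<le> 2}"

lemma orb_Suc_shift: "orbit n (Suc j) z = orbit (Suc n) j (step n z)"
  by (induction j) simp_all

lemma survivors_iff: "z \<in> survivors n \<longleftrightarrow> cmod (step n z) \<le> 2 \<and> step n z \<in> survivors (Suc n)"
proof -
  have "(\<forall>j. P j) \<longleftrightarrow> P 0 \<and> (\<forall>j. P (Suc j))" for P
    by (metis not0_implies_Suc)
  note this[of "\<lambda>j. cmod (orbit n (Suc j) z) \<le> 2"]
  then show ?thesis
    unfolding survivors_def mem_Collect_eq orb_Suc_shift by simp
qed

lemma norm_orb_le: "z \<in> survivors 0 \<Longrightarrow> n \<ge> 1 \<Longrightarrow> cmod (orbit 0 n z) \<le> 2"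
  by (cases n) (auto simp: survivors_def)

lemma N_ge_2: "N j \<ge> 2"
  using N_even[of j] N_pos[of j] by (cases "N j = 1") auto

lemma N_ge_5: 
  assumes "j \<ge> 1"
  shows "N j \<ge> 5"
proof (rule ccontr)
  assume "\<not> N j \<ge> 5"
  then have "(2::real) ^ N j \<le> 2 ^ 4" by (intro power_increasing) auto
  then show False using c_large[of j] c_small[OF assms] by simp
qed

lemma norm_power_bounds:
  assumes "cmod (step n z) \<le> 2"
  shows "cmod (c n) - 2 \<le> cmod z ^ N n" "cmod z ^ N n \<le> cmod (c n) + 2"
  using assms norm_triangle_ineq4[of "step n z" "c n"] norm_triangle_ineq4[of "step n z" "z ^ N n"]
  by (simp_all add: step_def norm_power)

lemma step_in_disc_imp:
  assumes "cmod (step n z) \<le> 2"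
  shows "cmod z ^ N n > 2" "cmod z > 1" "z \<noteq> 0"
proof -
  show 1: "cmod z ^ N n > 2"
    using norm_power_bounds[OF assms] c_large[of n] by simp
  then show 2: "cmod z > 1"
    by (smt (verit) norm_ge_zero power_le_one)
  then show "z \<noteq> 0" by auto
qed

text \<open>Outside the disc of radius 2 the power dominates: \<open>cmod (c n)\<close> is at most a quarter
  of \<open>2 ^ N n\<close>, hence of \<open>cmod w ^ N n\<close>, and \<open>N n \<ge> 5\<close>.\<close>
lemma escape:
  assumes "cmod w \<ge> 2" "n \<ge> 1"
  shows "cmod (step n w) \<ge> 2 * cmod w"
proof -
  obtain M where M: "N n = Suc M" "M \<ge> 3" using N_ge_5[OF assms(2)] by (cases "N n") auto
  have pw: "(2::real) ^ N n \<le> cmod w ^ N n" using assms(1) by (intro power_mono) auto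
  have "(2::real) ^ 3 \<le> 2 ^ M" using M(2) by (intro power_increasing) auto
  also have "\<dots> \<le> cmod w ^ M" using assms(1) by (intro power_mono) auto
  finally have "8 * cmod w \<le> cmod w ^ N n"
    using M(1) by (simp add: mult.commute[of "cmod w"] mult_right_mono)
  moreover have "cmod w ^ N n - cmod (c n) \<le> cmod (step n w)"
    using norm_triangle_ineq4[of "step n w" "c n"] by (simp add: step_def norm_power)
  moreover have "4 * cmod (c n) \<le> cmod w ^ N n"
    using c_small[OF assms(2)] pw by linarith
  ultimately show ?thesis using norm_ge_zero[of w] by linarith
qed

lemma escape_orb:
  assumes "cmod (orbit 0 n z) \<ge> 2" "n \<ge> 1"
  shows "cmod (orbit 0 (n + i) z) \<ge> 2 ^ Suc i"
proof (induction i)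
  case (Suc i)
  have "(2::real) \<le> 2 ^ Suc i" by simp
  then have "cmod (orbit 0 (n + i) z) \<ge> 2" using Suc by linarith
  then have "cmod (step (n + i) (orbit 0 (n + i) z)) \<ge> 2 * cmod (orbit 0 (n + i) z)"
    by (rule escape) (use assms(2) in simp)
  then show ?case using Suc by simp
qed (use assms in simp)

lemma norm_le_of_step:
  assumes s: "cmod (step 0 z) \<le> 2"
  shows "cmod z \<le> cmod (c 0) + 2"
proof -
  have "cmod z \<le> cmod z ^ N 0"
    using step_in_disc_imp(2)[OF s] N_pos[of 0] self_le_power[of "cmod z" "N 0"] by simp
  then show ?thesis using norm_power_bounds(2)[OF s] by linarith
qed

lemma continuous_orb: "continuous_on S (orbit n j)"
  by (induction j) (auto simp: step_def intro!: continuous_intros)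

lemma compact_survivors: "compact (survivors 0)"
proof -
  have "survivors 0 = (\<Inter>j. {z. cmod (orbit 0 (Suc j) z) \<le> 2})"
    by (auto simp: survivors_def simp del: orbit.simps)
  moreover have "closed {z. cmod (orbit 0 (Suc j) z) \<le> 2}" for j
    by (intro closed_Collect_le continuous_intros continuous_orb)
  ultimately have "closed (survivors 0)"
    by (simp add: closed_INT del: orbit.simps)
  moreover have "bounded (survivors 0)"
    unfolding bounded_iff using norm_le_of_step survivors_iff by blast
  ultimately show ?thesis by (simp add: compact_eq_bounded_closed)
qed

lemma rotate_survivors:
  assumes "z \<in> survivors n" "\<omega> ^ N n = 1"
  shows "\<omega> * z \<in> survivors n"
  using assms by (simp add: survivors_iff[of _ n] step_def power_mult_distrib)

lemma uminus_survivors: "z \<in> survivors n \<Longrightarrow> - z \<in> survivors n"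
  using rotate_survivors[of z n "-1"] N_even by simp

section \<open>Inverse branches and their distortion\<close>

text \<open>The inverse of \<open>step n\<close> on the disc of radius 2 that maps \<open>step n p\<close> to
  \<open>p\<close>. With the root taken of the quotient by \<open>p ^ N n\<close>, the principal logarithm
  serves for every \<open>p\<close>.\<close>
definition branch :: "nat \<Rightarrow> complex \<Rightarrow> complex \<Rightarrow> complex" where
  "branch n p w = p * exp (Ln ((w - c n) / p ^ N n) / of_nat (N n))"

text \<open>This is \<open>1 / cmod (deriv (step n) p)\<close>, the factor by which the inverse branch at
  \<open>p\<close> scales near \<open>step n p\<close>.\<close>
definition scale :: "nat \<Rightarrow> complex \<Rightarrow> real" where
  "scale n p = cmod p / (real (N n) * cmod p ^ N n)"

lemma branch_base:
  assumes "p \<noteq> 0"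
  shows "branch n p (step n p) = p"
  using assms by (simp add: branch_def step_def)

lemma branch_arg_ne:
  assumes "cmod w \<le> 2" 
  shows "w \<noteq> c n"
  using c_large[of n] assms by auto

lemma branch_power:
  assumes "p \<noteq> 0" "cmod w \<le> 2"
  shows "branch n p w ^ N n = w - c n"
proof -
  have "(w - c n) / p ^ N n \<noteq> 0" using branch_arg_ne[OF assms(2), of n] assms(1) by simp
  moreover have "exp (Ln x / of_nat (N n)) ^ N n = exp (Ln x)" for x
    using N_pos[of n] by (simp add: exp_of_nat_mult[symmetric])
  ultimately show ?thesis using assms(1) by (simp add: branch_def power_mult_distrib)
qed

lemma step_branch:
  assumes "p \<noteq> 0" "cmod w \<le> 2"
  shows "step n (branch n p w) = w"
  using branch_power[OF assms] by (simp add: step_def)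

lemma norm_branch_power:
  assumes "p \<noteq> 0" "cmod w \<le> 2"
  shows "cmod (branch n p w) ^ N n = cmod (w - c n)"
  unfolding branch_power[OF assms, of n, symmetric] by (simp add: norm_power)

lemma norm_branch_le:
  assumes "n \<ge> 1" "p \<noteq> 0" "cmod w \<le> 2"
  shows "cmod (branch n p w) \<le> 2"
proof -
  have "cmod (w - c n) \<le> 2 + cmod (c n)" using norm_triangle_ineq4[of w "c n"] assms(3) by simp
  also have "\<dots> \<le> 4 * cmod (c n)" using c_large[of n] by simp
  also have "\<dots> \<le> 2 ^ N n" by (rule c_small[OF assms(1)])
  finally have "cmod (branch n p w) ^ N n \<le> 2 ^ N n" using norm_branch_power[OF assms(2,3)] by simp
  then show ?thesis using power_mono_iff[of "cmod (branch n p w)" 2 "N n"] N_pos[of n] by simp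
qed

text \<open>If the quotient were \<open>s \<le> 0\<close>, then 0 would be a convex combination of the points
  \<open>w - c n\<close> and \<open>p ^ N n\<close> of the disc of radius 2 around \<open>- c n\<close>;
  this disc does not contain 0.\<close>
lemma ratio_not_nonpos_Reals:
  assumes "cmod (step n p) \<le> 2" "cmod w \<le> 2"
  shows "(w - c n) / p ^ N n \<notin> \<real>\<^sub>\<le>\<^sub>0"
proof
  assume "(w - c n) / p ^ N n \<in> \<real>\<^sub>\<le>\<^sub>0"
  then obtain s where s: "(w - c n) / p ^ N n = of_real s" "s \<le> 0"
    by (auto simp: nonpos_Reals_def elim: Reals_cases)
  have "p \<noteq> 0" using step_in_disc_imp[OF assms(1)] by simp
  then have "w - c n = of_real s * p ^ N n" using s(1) by (simp add: field_simps)
  then have eq: "w - of_real s * step n p = of_real (1 - s) * c n"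
    by (simp add: step_def algebra_simps)
  have "cmod (of_real s * step n p) \<le> - s * 2"
    unfolding norm_mult norm_of_real using s(2) assms(1) by (intro mult_mono) auto
  then have "cmod (w - of_real s * step n p) \<le> 2 + (- s) * 2"
    using norm_triangle_ineq4[of w "of_real s * step n p"] assms(2) by linarith
  then have le: "(1 - s) * cmod (c n) \<le> (1 - s) * 2"
    unfolding eq norm_mult norm_of_real using s(2) by (simp add: algebra_simps)
  then have "cmod (c n) \<le> 2"
    using s(2) mult_le_cancel_left_pos[of "1 - s"]
    by (metis diff_gt_0_iff_gt le_less_trans zero_less_one)
  then show False using c_large[of n] by simp
qed

lemma DERIV_branch:
  assumes "cmod (step n p) \<le> 2" "cmod w \<le> 2"
  shows "(branch n p has_field_derivative branch n p w / (of_nat (N n) * (w - c n))) (at w within S)"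
proof -
  have chain: "((\<lambda>w. p * exp (Ln ((w - b) / P) / M)) has_field_derivative
      p * exp (Ln ((w - b) / P) / M) / (M * (w - b))) (at w within S)"
    if "(w - b) / P \<notin> \<real>\<^sub>\<le>\<^sub>0" "M \<noteq> 0" for b P M :: complex
    using that by (auto intro!: derivative_eq_intros simp: field_simps)
      (simp add: right_diff_distrib[symmetric])
  show ?thesis
    unfolding branch_def using ratio_not_nonpos_Reals[OF assms] N_pos[of n] by (intro chain) auto
qed

lemma scale_pos: "p \<noteq> 0 \<Longrightarrow> scale n p > 0"
  using N_pos[of n] by (simp add: scale_def)

text \<open>The branch \<open>h\<close> satisfies \<open>h' = h / (N * (w - c))\<close> and
  \<open>cmod h ^ N = cmod (w - c)\<close>. At a distance of at most \<open>\<rho>\<close> from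
  \<open>step n p\<close>, inside the disc of radius 2, the modulus of \<open>w - c\<close> changes by a
  factor of at most \<open>exp (\<rho> / 2)\<close>, so the derivative changes by at most
  \<open>exp \<rho>\<close>.\<close>
lemma branch_upper:
  assumes p: "cmod (step n p) \<le> 2" and w: "cmod w \<le> 2" "cmod w' \<le> 2"
    and \<rho>: "cmod (w - step n p) \<le> \<rho>" "cmod (w' - step n p) \<le> \<rho>"
  shows "cmod (branch n p w - branch n p w') \<le> scale n p * exp \<rho> * cmod (w - w')"
proof (rule field_differentiable_bound)
  let ?D = "cball 0 2 \<inter> cball (step n p) \<rho>"
  show "convex ?D" by (intro convex_Int convex_cball)
  show "w \<in> ?D" "w' \<in> ?D" using w \<rho> by (auto simp: dist_norm norm_minus_commute)
  fix x assume x: "x \<in> ?D"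
  then show "(branch n p has_field_derivative branch n p x / (of_nat (N n) * (x - c n))) (at x within ?D)"
    by (intro DERIV_branch p) simp
  have p0: "p \<noteq> 0" "cmod p > 1" using step_in_disc_imp[OF p] by auto
  have xd: "cmod x \<le> 2" "cmod (x - step n p) \<le> \<rho>" using x by (auto simp: dist_norm norm_minus_commute)
  define a where "a = cmod (x - c n)"
  define b where "b = cmod p ^ N n"
  have b: "b > 2" unfolding b_def by (rule step_in_disc_imp[OF p])
  have a: "a > 2" using norm_triangle_ineq2[of "c n" x] c_large[of n] xd(1) by (simp add: a_def norm_minus_commute)
  have pw: "p ^ N n = step n p - c n" by (simp add: step_def)
  have "b = cmod (step n p - c n)" unfolding b_def pw[symmetric] by (simp add: norm_power)
  then have ab: "\<bar>a - b\<bar> \<le> \<rho>"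
    using norm_triangle_ineq3[of "x - c n" "step n p - c n"] xd(2) by (simp add: a_def)
  \<comment> \<open>The moduli \<open>a\<close> and \<open>b\<close> exceed 2, so a difference of at most \<open>\<rho>\<close> is a factor of at most \<open>1 + \<rho> / 2\<close>.\<close>
  have ex: "u \<le> v * exp (\<rho> / 2)" if "u > 2" "v > 2" "\<bar>u - v\<bar> \<le> \<rho>" for u v
  proof -
    have "\<rho> / v \<le> \<rho> / 2" using that by (intro divide_left_mono) auto
    moreover have "u / v \<le> 1 + \<rho> / v"
      using that by (simp add: field_simps)
    ultimately have "u / v \<le> 1 + \<rho> / 2" by linarith
    also have "\<dots> \<le> exp (\<rho> / 2)" by (rule exp_ge_add_one_self)
    finally show ?thesis using that by (simp add: field_simps)
  qed
  have abe: "a \<le> b * exp (\<rho> / 2)" "b \<le> a * exp (\<rho> / 2)"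
    using ex[OF a b ab] ex[OF b a] ab by (simp_all add: abs_minus_commute)
  define h where "h = cmod (branch n p x)"
  have h: "h ^ N n = a" unfolding h_def a_def by (rule norm_branch_power[OF p0(1) xd(1)])
  have "\<rho> \<ge> 0" using xd(2) norm_ge_zero order_trans by blast
  have "h ^ N n \<le> (cmod p * exp (\<rho> / 2)) ^ N n"
  proof -
    have "a \<le> b * exp (\<rho> / 2)" by (rule abe)
    also have "\<dots> \<le> b * exp (\<rho> / 2) ^ N n"
      using b \<open>\<rho> \<ge> 0\<close> N_pos[of n] by (intro mult_left_mono self_le_power) auto
    finally show ?thesis unfolding h by (simp add: b_def power_mult_distrib)
  qed
  then have hp: "h \<le> cmod p * exp (\<rho> / 2)"
    using power_mono_iff[of h "cmod p * exp (\<rho> / 2)" "N n"] N_pos[of n] by (simp add: h_def)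
  have "h * b \<le> (cmod p * exp (\<rho> / 2)) * (a * exp (\<rho> / 2))"
    using hp abe(2) b by (intro mult_mono) auto
  also have "\<dots> = cmod p * a * exp \<rho>"
    by (simp add: mult_exp_exp algebra_simps)
  finally have "h / a \<le> cmod p / b * exp \<rho>"
    using a b by (simp add: field_simps)
  then have "h / a / real (N n) \<le> cmod p / b * exp \<rho> / real (N n)"
    by (rule divide_right_mono) simp
  then show "cmod (branch n p x / (of_nat (N n) * (x - c n))) \<le> scale n p * exp \<rho>"
    by (simp add: norm_divide norm_mult scale_def h_def a_def b_def mult_ac)
qed

lemma norm_power_diff_le:
  fixes x y :: complex
  assumes "cmod x \<le> M" "cmod y \<le> M"
  shows "cmod (x ^ k - y ^ k) \<le> real k * M ^ (k - 1) * cmod (x - y)"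
proof (rule field_differentiable_bound[of "cball 0 M" _ "\<lambda>z. of_nat k * z ^ (k - 1)"])
  fix z :: complex assume "z \<in> cball 0 M"
  then have "cmod z ^ (k - 1) \<le> M ^ (k - 1)" by (intro power_mono) auto
  then show "cmod (of_nat k * z ^ (k - 1)) \<le> real k * M ^ (k - 1)"
    by (simp add: norm_mult norm_power mult_left_mono)
qed (use assms in \<open>auto intro!: derivative_eq_intros\<close>)

lemma power_pred: "x \<noteq> 0 \<Longrightarrow> x ^ (N n - 1) = (x ^ N n / x :: real)"
  using N_pos[of n] by (simp add: power_diff)

text \<open>The power map is Lipschitz on a disc, with the constant given by its derivative on the boundary; a
  bound on how much \<open>z ^ N\<close> stretches distances is a bound on how little the branch does.\<close>
lemma branch_lower:
  assumes p: "cmod (step n p) \<le> 2" and w: "cmod w \<le> 2" "cmod w' \<le> 2"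
    and \<rho>: "cmod (w - step n p) \<le> \<rho>" "cmod (w' - step n p) \<le> \<rho>"
  shows "scale n p * exp (- \<rho>) * cmod (w - w') \<le> cmod (branch n p w - branch n p w')"
proof -
  have p0: "p \<noteq> 0" "cmod p > 1" using step_in_disc_imp[OF p] by auto
  have pN: "cmod p ^ N n > 2" by (rule step_in_disc_imp[OF p])
  have "\<rho> \<ge> 0" using \<rho>(1) norm_ge_zero order_trans by blast
  have grow: "cmod (branch n p x) ^ N n \<le> cmod p ^ N n * exp \<rho> \<and> cmod (branch n p x) > 1"
    if x: "cmod x \<le> 2" "cmod (x - step n p) \<le> \<rho>" for x
  proof -
    have pw: "x - c n = p ^ N n + (x - step n p)" by (simp add: step_def)
    have "cmod (branch n p x) ^ N n = cmod (x - c n)" by (rule norm_branch_power[OF p0(1) x(1)])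
    also have "\<dots> \<le> cmod p ^ N n + \<rho>"
      unfolding pw using norm_triangle_ineq[of "p ^ N n" "x - step n p"] x(2) by (simp add: norm_power)
    also have "\<dots> \<le> cmod p ^ N n * (1 + \<rho>)"
      using pN \<open>\<rho> \<ge> 0\<close> mult_right_mono[of 1 "cmod p ^ N n" \<rho>] by (simp add: algebra_simps)
    also have "\<dots> \<le> cmod p ^ N n * exp \<rho>"
      by (intro mult_left_mono exp_ge_add_one_self) auto
    finally show ?thesis
      using step_in_disc_imp(2)[of n "branch n p x"] step_branch[OF p0(1) x(1), of n] x(1) by simp
  qed
  define M where "M = max (cmod p) (max (cmod (branch n p w)) (cmod (branch n p w')))"
  have "M \<in> {cmod p, cmod (branch n p w), cmod (branch n p w')}" by (auto simp: M_def max_def)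
  moreover have "cmod p ^ N n \<le> cmod p ^ N n * exp \<rho>"
    using \<open>\<rho> \<ge> 0\<close> by (simp add: mult_le_cancel_left1)
  ultimately have MN: "M ^ N n \<le> cmod p ^ N n * exp \<rho>"
    using grow[OF w(1) \<rho>(1)] grow[OF w(2) \<rho>(2)] by auto
  have M: "cmod (branch n p w) \<le> M" "cmod (branch n p w') \<le> M" "cmod p \<le> M" "M > 0"
    using p0 by (auto simp: M_def)
  have "w - w' = branch n p w ^ N n - branch n p w' ^ N n"
    using branch_power[OF p0(1)] w by simp
  then have "cmod (w - w') \<le> real (N n) * M ^ (N n - 1) * cmod (branch n p w - branch n p w')"
    using norm_power_diff_le[OF M(1,2), of "N n"] by simp
  also have "M ^ (N n - 1) = M ^ N n / M" by (rule power_pred) (use M(4) in simp)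
  also have "real (N n) * (M ^ N n / M) * cmod (branch n p w - branch n p w')
     \<le> real (N n) * (cmod p ^ N n * exp \<rho> / cmod p) * cmod (branch n p w - branch n p w')"
    using MN M p0 by (intro mult_right_mono mult_left_mono frac_le) auto
  also have "\<dots> = exp \<rho> / scale n p * cmod (branch n p w - branch n p w')"
    by (simp add: scale_def)
  finally show ?thesis
    using scale_pos[OF p0(1), of n] by (simp add: exp_minus field_simps)
qed

text \<open>The derivative \<open>h / (N * (w - c))\<close> is at most \<open>2 / (5 * 2)\<close> in
  modulus.\<close>
lemma branch_contracts:
  assumes n: "n \<ge> 1" and p: "cmod (step n p) \<le> 2" and w: "cmod w \<le> 2" "cmod w' \<le> 2"
  shows "cmod (branch n p w - branch n p w') \<le> cmod (w - w') / 4"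
proof -
  have p0: "p \<noteq> 0" using step_in_disc_imp[OF p] by auto
  have "cmod (branch n p w - branch n p w') \<le> 1 / 4 * cmod (w - w')"
  proof (rule field_differentiable_bound[OF convex_cball])
    fix x assume x: "x \<in> cball (0::complex) 2"
    then show "(branch n p has_field_derivative branch n p x / (of_nat (N n) * (x - c n))) (at x within cball 0 2)"
      by (intro DERIV_branch p) simp
    have x2: "cmod x \<le> 2" using x by simp
    have "cmod (x - c n) > 2" using norm_triangle_ineq2[of "c n" x] c_large[of n] x2 by (simp add: norm_minus_commute)
    moreover have "real (N n) \<ge> 5" using N_ge_5[OF n] by simp
    ultimately have "5 * 2 \<le> real (N n) * cmod (x - c n)" by (intro mult_mono) auto
    moreover have "cmod (branch n p x) \<le> 2" by (rule norm_branch_le[OF n p0 x2])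
    ultimately have "cmod (branch n p x) / (real (N n) * cmod (x - c n)) \<le> 2 / (5 * 2)"
      by (intro frac_le) auto
    then show "cmod (branch n p x / (of_nat (N n) * (x - c n))) \<le> 1 / 4"
      by (simp add: norm_divide norm_mult)
  qed (use w in auto)
  then show ?thesis by simp
qed

text \<open>Different preimages are separated by a distance of order \<open>cmod p / N\<close>: when
  \<open>q / p\<close> is this close to 1, its logarithm times \<open>N\<close> is still the principal
  logarithm of \<open>(q / p) ^ N\<close>.\<close>
lemma near_imp_branch:
  assumes p: "cmod (step n p) \<le> 2" and q: "cmod (step n q) \<le> 2"
    and near: "cmod (q - p) < cmod p / (2 * real (N n))"
  shows "q = branch n p (step n q)"
proof -
  have p0: "p \<noteq> 0" "q \<noteq> 0" using step_in_disc_imp[OF p] step_in_disc_imp[OF q] by auto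
  define s where "s = (q - p) / p"
  have q_eq: "q / p = 1 + s" using p0 by (simp add: s_def diff_divide_distrib)
  have Ns: "real (N n) * cmod s < 1 / 2"
    using near p0 N_pos[of n] by (simp add: s_def norm_divide field_simps)
  have "cmod s \<le> real (N n) * cmod s" using N_pos[of n] by (simp add: mult_le_cancel_right1)
  then have s: "cmod s < 1 / 2" using Ns by linarith
  have "cmod (Ln (1 + s)) \<le> 2 * cmod s" using norm_Ln_le[of s] s by simp
  then have "cmod (of_nat (N n) * Ln (1 + s)) \<le> real (N n) * (2 * cmod s)"
    by (simp add: norm_mult mult_left_mono)
  then have "cmod (of_nat (N n) * Ln (1 + s)) < 1" using Ns by simp
  then have "\<bar>Im (of_nat (N n) * Ln (1 + s))\<bar> < pi"
    using abs_Im_le_cmod[of "of_nat (N n) * Ln (1 + s)"] pi_ge_two by linarith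
  then have "Ln (exp (of_nat (N n) * Ln (1 + s))) = of_nat (N n) * Ln (1 + s)"
    by (intro Ln_exp) auto
  moreover have "1 + s \<noteq> 0" using q_eq p0 by (metis divide_eq_0_iff)
  then have "exp (of_nat (N n) * Ln (1 + s)) = (q / p) ^ N n"
    by (simp add: exp_of_nat_mult q_eq)
  ultimately have "Ln ((q / p) ^ N n) / of_nat (N n) = Ln (1 + s)"
    using N_pos[of n] by simp
  then have "branch n p (step n q) = p * exp (Ln (1 + s))"
    by (simp add: branch_def step_def power_divide)
  then show ?thesis using \<open>1 + s \<noteq> 0\<close> q_eq[symmetric] p0 by simp
qed

text \<open>\<open>pullback z n\<close> is the inverse branch of the \<open>n\<close>-fold composition along
  the orbit of \<open>z\<close>. The images of the sets \<open>survivors n\<close> under these maps are the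
  cylinders of the Cantor set \<open>survivors 0\<close>.\<close>
primrec pullback :: "complex \<Rightarrow> nat \<Rightarrow> complex \<Rightarrow> complex" where
  "pullback z 0 w = w"
| "pullback z (Suc n) w = pullback z n (branch n (orbit 0 n z) w)"

definition total_scale :: "complex \<Rightarrow> nat \<Rightarrow> real" where
  "total_scale z n = (\<Prod>j<n. scale j (orbit 0 j z))"

lemma norm_survivors_le_2:
  assumes "w \<in> survivors n" "n \<ge> 1"
  shows "cmod w \<le> 2"
proof (rule ccontr)
  assume "\<not> cmod w \<le> 2"
  then have w: "cmod w > 2" by simp
  have "cmod (step n w) \<ge> 2 * cmod w" using w assms(2) by (intro escape) auto
  moreover have "cmod (step n w) \<le> 2" using assms(1) survivors_iff by blast
  ultimately show False using w by simp
qed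

lemma norm_step_orb_le: "z \<in> survivors 0 \<Longrightarrow> cmod (step n (orbit 0 n z)) \<le> 2"
  using norm_orb_le[of z "Suc n"] by simp

lemma orb_ne_0: "z \<in> survivors 0 \<Longrightarrow> orbit 0 n z \<noteq> 0"
  using step_in_disc_imp(3)[OF norm_step_orb_le] by blast

lemma pullback_base: "z \<in> survivors 0 \<Longrightarrow> pullback z n (orbit 0 n z) = z"
proof (induction n)
  case (Suc n)
  then show ?case using branch_base[of "orbit 0 n z" n] orb_ne_0 by simp
qed simp

lemma orb_pullback:
  assumes z: "z \<in> survivors 0"
  shows "(n \<ge> 1 \<Longrightarrow> cmod w \<le> 2) \<Longrightarrow> orbit 0 n (pullback z n w) = w"
proof (induction n arbitrary: w)
  case (Suc n)
  have w: "cmod w \<le> 2" using Suc.prems by simp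
  have "orbit 0 n (pullback z n (branch n (orbit 0 n z) w)) = branch n (orbit 0 n z) w"
    by (rule Suc.IH, rule norm_branch_le) (use orb_ne_0[OF z] w in auto)
  then show ?case using step_branch[OF orb_ne_0[OF z] w] by simp
qed simp

lemma branch_in_survivors:
  assumes "z \<in> survivors 0" "w \<in> survivors (Suc n)"
  shows "branch n (orbit 0 n z) w \<in> survivors n"
  using assms norm_survivors_le_2[OF assms(2)] by (simp add: survivors_iff[of _ n] step_branch orb_ne_0)

lemma pullback_in_survivors:
  assumes z: "z \<in> survivors 0"
  shows "w \<in> survivors n \<Longrightarrow> pullback z n w \<in> survivors 0"
  by (induction n arbitrary: w) (use branch_in_survivors[OF z] in auto)

lemma total_scale_pos: "z \<in> survivors 0 \<Longrightarrow> total_scale z n > 0"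
  unfolding total_scale_def by (intro prod_pos ballI scale_pos orb_ne_0)

lemma scale_le_half:
  assumes "cmod (step n p) \<le> 2"
  shows "scale n p \<le> 1 / 2"
proof -
  have p: "cmod p > 1" by (rule step_in_disc_imp[OF assms])
  then have pN: "cmod p \<le> cmod p ^ N n" using N_pos[of n] by (intro self_le_power) auto
  have "2 * cmod p \<le> real (N n) * cmod p ^ N n"
    using N_ge_2[of n] pN by (intro mult_mono) auto
  then show ?thesis
    unfolding scale_def using p N_pos[of n] by (simp add: divide_le_eq)
qed

lemma total_scale_le:
  assumes "z \<in> survivors 0"
  shows "total_scale z n \<le> (1 / 2) ^ n"
proof -
  have "total_scale z n \<le> (\<Prod>j<n. 1 / 2)"
    unfolding total_scale_def
    by (intro prod_mono conjI scale_le_half norm_step_orb_le assms less_imp_le[OF scale_pos] orb_ne_0)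
  then show ?thesis by simp
qed

lemma total_scale_Suc: "total_scale z (Suc n) = total_scale z n * scale n (orbit 0 n z)"
  by (simp add: total_scale_def)

text \<open>The exponents of the one-step estimates add up along the orbit. Every step beyond the first
  contracts by 4, so they form a geometric series, and the total exponent is at most
  \<open>2 * \<rho>\<close>. In the induction,
  \<open>\<rho> + 2 * (\<rho> / 4) \<le> 2 * \<rho>\<close>. The first map need not contract, but
  nothing precedes it.\<close>
lemma pullback_distortion:
  assumes z: "z \<in> survivors 0"
  shows "(n \<ge> 1 \<Longrightarrow> cmod w \<le> 2 \<and> cmod w' \<le> 2) \<Longrightarrow>
     cmod (w - orbit 0 n z) \<le> \<rho> \<Longrightarrow> cmod (w' - orbit 0 n z) \<le> \<rho> \<Longrightarrow>
     total_scale z n * exp (- 2 * \<rho>) * cmod (w - w') \<le> cmod (pullback z n w - pullback z n w') \<and>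
     cmod (pullback z n w - pullback z n w') \<le> total_scale z n * exp (2 * \<rho>) * cmod (w - w')"
proof (induction n arbitrary: w w' \<rho>)
  case 0
  have "\<rho> \<ge> 0" using 0(2) norm_ge_zero order_trans by blast
  then show ?case
    by (simp add: total_scale_def mult_left_le_one_le mult_le_cancel_right1)
next
  case (Suc n)
  define p where "p = orbit 0 n z"
  define v v' where "v = branch n p w" and "v' = branch n p w'"
  have w: "cmod w \<le> 2" "cmod w' \<le> 2" using Suc.prems(1) by auto
  have p: "cmod (step n p) \<le> 2" unfolding p_def by (rule norm_step_orb_le[OF z])
  have p0: "p \<noteq> 0" by (rule step_in_disc_imp[OF p])
  have wp: "cmod (w - step n p) \<le> \<rho>" "cmod (w' - step n p) \<le> \<rho>"
    using Suc.prems(2,3) by (simp_all add: p_def)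
  have \<rho>: "\<rho> \<ge> 0" using wp(1) norm_ge_zero order_trans by blast
  note S = total_scale_Suc[of z n, folded p_def]
  have sp: "scale n p > 0" "total_scale z n > 0" using scale_pos[OF p0] total_scale_pos[OF z] by auto
  have vv: "scale n p * exp (- \<rho>) * cmod (w - w') \<le> cmod (v - v')"
           "cmod (v - v') \<le> scale n p * exp \<rho> * cmod (w - w')"
    unfolding v_def v'_def by (rule branch_lower[OF p w wp] branch_upper[OF p w wp])+
  define e where "e = (if n = 0 then 0 else \<rho> / 2)"
  have pull: "total_scale z n * exp (- e) * cmod (v - v') \<le> cmod (pullback z n v - pullback z n v') \<and>
     cmod (pullback z n v - pullback z n v') \<le> total_scale z n * exp e * cmod (v - v')"
  proof (cases "n = 0")
    case True
    then show ?thesis by (simp add: e_def total_scale_def)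
  next
    case False
    then have n: "n \<ge> 1" by simp
    have near: "cmod (branch n p x - p) \<le> \<rho> / 4" if "cmod x \<le> 2" "cmod (x - step n p) \<le> \<rho>" for x
      using branch_contracts[OF n p that(1) p] branch_base[OF p0, of n] that(2) by simp
    have "- 2 * (\<rho> / 4) = - e" "2 * (\<rho> / 4) = e" using False by (simp_all add: e_def)
    moreover have "cmod v \<le> 2 \<and> cmod v' \<le> 2"
      unfolding v_def v'_def using norm_branch_le[OF n p0] w by blast
    moreover have "cmod (v - orbit 0 n z) \<le> \<rho> / 4" "cmod (v' - orbit 0 n z) \<le> \<rho> / 4"
      using near w wp by (simp_all add: v_def v'_def p_def)
    ultimately show ?thesis
      using Suc.IH[of v v' "\<rho> / 4"] by simp
  qed
  have e: "e + \<rho> \<le> 2 * \<rho>" using \<rho> by (simp add: e_def)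
  have "total_scale z (Suc n) * exp (- 2 * \<rho>) * cmod (w - w')
      \<le> total_scale z n * scale n p * (exp (- e) * exp (- \<rho>)) * cmod (w - w')"
    unfolding S mult_exp_exp using e sp by (intro mult_right_mono mult_left_mono) auto
  also have "\<dots> = total_scale z n * exp (- e) * (scale n p * exp (- \<rho>) * cmod (w - w'))"
    by (simp add: mult_ac)
  also have "\<dots> \<le> total_scale z n * exp (- e) * cmod (v - v')"
    using vv(1) sp by (intro mult_left_mono) auto
  finally have lower: "total_scale z (Suc n) * exp (- 2 * \<rho>) * cmod (w - w') \<le> cmod (pullback z n v - pullback z n v')"
    using pull by linarith
  have "total_scale z n * exp e * cmod (v - v') \<le> total_scale z n * exp e * (scale n p * exp \<rho> * cmod (w - w'))"
    using vv(2) sp by (intro mult_left_mono) auto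
  also have "\<dots> = total_scale z n * scale n p * (exp e * exp \<rho>) * cmod (w - w')"
    by (simp add: mult_ac)
  also have "\<dots> \<le> total_scale z (Suc n) * exp (2 * \<rho>) * cmod (w - w')"
    unfolding S mult_exp_exp using e sp by (intro mult_right_mono mult_left_mono) auto
  finally have upper: "cmod (pullback z n v - pullback z n v') \<le> total_scale z (Suc n) * exp (2 * \<rho>) * cmod (w - w')"
    using pull by linarith
  show ?case
    using lower upper by (simp add: v_def v'_def p_def)
qed

text \<open>Two points of the disc of radius 2 have distance at most 4, which makes the distortion a constant
  that depends neither on the number of steps nor on the maps.\<close>
lemma pullback_bilipschitz:
  assumes z: "z \<in> survivors 0" and w: "n \<ge> 1 \<Longrightarrow> cmod w \<le> 2 \<and> cmod w' \<le> 2"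
  shows "total_scale z n * exp (- 8) * cmod (w - w') \<le> cmod (pullback z n w - pullback z n w')"
    and "cmod (pullback z n w - pullback z n w') \<le> total_scale z n * exp 8 * cmod (w - w')"
proof -
  have "total_scale z n * exp (- 8) * cmod (w - w') \<le> cmod (pullback z n w - pullback z n w') \<and>
     cmod (pullback z n w - pullback z n w') \<le> total_scale z n * exp 8 * cmod (w - w')"
  proof (cases "n = 0")
    case True
    then show ?thesis by (simp add: total_scale_def mult_left_le_one_le mult_le_cancel_right1)
  next
    case False
    then have n: "n \<ge> 1" by simp
    have "cmod (x - orbit 0 n z) \<le> 4" if "cmod x \<le> 2" for x
      using norm_triangle_ineq4[of x "orbit 0 n z"] norm_orb_le[OF z n] that by simp
    then show ?thesis using pullback_distortion[OF z, of n w w' 4] w n by simp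
  qed
  then show "total_scale z n * exp (- 8) * cmod (w - w') \<le> cmod (pullback z n w - pullback z n w')"
    and "cmod (pullback z n w - pullback z n w') \<le> total_scale z n * exp 8 * cmod (w - w')" by blast+
qed

lemma pullback_near:
  assumes z: "z \<in> survivors 0" and "n \<ge> 1" "cmod w \<le> 2"
  shows "cmod (pullback z n w - z) \<le> 4 * exp 8 * total_scale z n"
proof -
  have o: "cmod (orbit 0 n z) \<le> 2" using norm_orb_le[OF z] assms(2) .
  have "cmod (pullback z n w - pullback z n (orbit 0 n z)) \<le> total_scale z n * exp 8 * cmod (w - orbit 0 n z)"
    by (rule pullback_bilipschitz[OF z]) (use assms o in auto)
  also have "\<dots> \<le> total_scale z n * exp 8 * 4"
    using norm_triangle_ineq4[of w "orbit 0 n z"] o assms(3) total_scale_pos[OF z, of n]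
    by (intro mult_left_mono) auto
  finally show ?thesis by (simp add: pullback_base[OF z] mult_ac)
qed

lemma pullback_eventually_near:
  assumes z: "z \<in> survivors 0" and "\<epsilon> > 0"
  obtains n where "n \<ge> 1" "\<And>w. cmod w \<le> 2 \<Longrightarrow> cmod (pullback z n w - z) < \<epsilon>"
proof -
  obtain m where m: "(1 / 2 :: real) ^ m < \<epsilon> / (4 * exp 8)"
    using real_arch_pow_inv[of "\<epsilon> / (4 * exp 8)" "1 / 2"] assms(2) by auto
  have "(1 / 2 :: real) ^ Suc m \<le> (1 / 2) ^ m" by simp
  then have "total_scale z (Suc m) < \<epsilon> / (4 * exp 8)"
    using total_scale_le[OF z, of "Suc m"] m by linarith
  then have "4 * exp 8 * total_scale z (Suc m) < \<epsilon>" by (simp add: field_simps)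
  then show ?thesis
    using that[of "Suc m"] pullback_near[OF z, of "Suc m"] by fastforce
qed

lemma escaping_points_near:
  assumes "z \<in> survivors 0" "\<epsilon> > 0"
  obtains x n where "cmod (x - z) < \<epsilon>" "n \<ge> 1" "cmod (orbit 0 n x) = 2"
proof -
  obtain n where n: "n \<ge> 1" "\<And>w. cmod w \<le> 2 \<Longrightarrow> cmod (pullback z n w - z) < \<epsilon>"
    using pullback_eventually_near[OF assms] by blast
  show ?thesis
  proof (rule that[OF _ n(1)])
    show "cmod (pullback z n 2 - z) < \<epsilon>" by (rule n(2)) simp
    show "cmod (orbit 0 n (pullback z n 2)) = 2"
      using orb_pullback[OF assms(1), of n 2] by simp
  qed
qed

text \<open>Each map from the second on has, for every point of the disc of radius 2, a preimage in this disc.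
  So the sets of points that survive finitely many steps are nonempty, compact and nested.\<close>
lemma survivors_nonempty: "survivors 0 \<noteq> {}"
proof -
  define K where "K n = {z. \<forall>j\<le>n. cmod (orbit 0 (Suc j) z) \<le> 2}" for n
  have ex: "\<exists>x. orbit 0 (Suc n) x = w \<and> (\<forall>j\<le>n. cmod (orbit 0 (Suc j) x) \<le> 2)" if "cmod w \<le> 2" for n w
    using that
  proof (induction n arbitrary: w)
    case 0
    then show ?case using step_branch[of 1 w 0] by (intro exI[of _ "branch 0 1 w"]) simp
  next
    case (Suc n)
    define v where "v = branch (Suc n) 1 w"
    have v: "step (Suc n) v = w" "cmod v \<le> 2"
      using step_branch[of 1 w "Suc n"] norm_branch_le[of "Suc n" 1 w] Suc.prems by (simp_all add: v_def)
    obtain x where x: "orbit 0 (Suc n) x = v" "\<forall>j\<le>n. cmod (orbit 0 (Suc j) x) \<le> 2"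
      using Suc.IH[OF v(2)] by blast
    have "orbit 0 (Suc (Suc n)) x = w" using x(1) v(1) by simp
    then show ?case using x(2) Suc.prems by (metis le_Suc_eq)
  qed
  have "closed (K n)" for n
  proof -
    have "K n = (\<Inter>j\<in>{..n}. {z. cmod (orbit 0 (Suc j) z) \<le> 2})" by (auto simp: K_def simp del: orbit.simps)
    then show ?thesis
      by (simp add: closed_INT closed_Collect_le continuous_on_norm continuous_orb del: orbit.simps)
  qed
  moreover have "bounded (K n)" for n
    unfolding bounded_iff
  proof (intro exI ballI)
    fix z assume "z \<in> K n"
    then have "cmod (orbit 0 (Suc 0) z) \<le> 2" unfolding K_def by blast
    then show "cmod z \<le> cmod (c 0) + 2" by (intro norm_le_of_step) simp
  qed
  ultimately have "compact (K n)" for n by (simp add: compact_eq_bounded_closed)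
  moreover have "K n \<noteq> {}" for n using ex[of 0 n] by (auto simp: K_def simp del: orbit.simps)
  moreover have "K n \<subseteq> K m" if "m \<le> n" for m n using that by (auto simp: K_def simp del: orbit.simps)
  ultimately have "\<Inter>(range K) \<noteq> {}" by (rule compact_nest)
  moreover have "\<Inter>(range K) \<subseteq> survivors 0" by (auto simp: K_def survivors_def simp del: orbit.simps)
  ultimately show ?thesis by blast
qed

lemma survivors_two_points: "\<exists>x\<in>survivors 0. \<exists>y\<in>survivors 0. x \<noteq> y"
proof -
  obtain z where z: "z \<in> survivors 0" using survivors_nonempty by blast
  then have "z \<noteq> 0" using orb_ne_0[of z 0] by simp
  then have "z \<noteq> - z" by simp
  with z uminus_survivors[OF z] show ?thesis by blast
qed

section \<open>Unbounded parameters: thin Julia sets\<close>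

text \<open>A survivor \<open>u\<close> either follows the same inverse branches as \<open>z\<close>, or its
  orbit takes another branch at some block \<open>j\<close>, where it then has distance at least of order
  \<open>cmod (orbit 0 j z) / N j\<close> from the orbit of \<open>z\<close>. By bounded distortion this
  distance reappears, scaled by \<open>total_scale z j\<close>, at the start. In the first claim the bound is
  relaxed to the total scale, which passes from one stage to the next because the total scales decrease.\<close>
lemma gap_around_cylinder:
  assumes z: "z \<in> survivors 0" and u: "u \<in> survivors 0"
  defines "R \<equiv> \<lambda>n. exp (- 8) * total_scale z n * cmod (orbit 0 n z) / (2 * real (N n))"
  shows "u = pullback z n (orbit 0 n u) \<or> exp (- 8) * total_scale z n \<le> cmod (u - z)"
    and "n \<ge> 1 \<Longrightarrow> u = pullback z (Suc n) (orbit 0 (Suc n) u) \<or> R n \<le> cmod (u - z)"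
proof -
  have step: "u = pullback z (Suc n) (orbit 0 (Suc n) u) \<or> R n \<le> cmod (u - z)"
    if "u = pullback z n (orbit 0 n u)" for n
  proof (cases "orbit 0 n u = branch n (orbit 0 n z) (orbit 0 (Suc n) u)")
    case True
    then show ?thesis using that by simp
  next
    case False
    then have far: "cmod (orbit 0 n z) / (2 * real (N n)) \<le> cmod (orbit 0 n u - orbit 0 n z)"
      using near_imp_branch[OF norm_step_orb_le[OF z] norm_step_orb_le[OF u], of n] by fastforce
    have "R n = total_scale z n * exp (- 8) * (cmod (orbit 0 n z) / (2 * real (N n)))"
      by (simp add: R_def)
    also have "\<dots> \<le> total_scale z n * exp (- 8) * cmod (orbit 0 n u - orbit 0 n z)"
      using far total_scale_pos[OF z, of n] by (intro mult_left_mono) auto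
    also have "\<dots> \<le> cmod (pullback z n (orbit 0 n u) - pullback z n (orbit 0 n z))"
      by (rule pullback_bilipschitz[OF z]) (use norm_orb_le u z in auto)
    finally show ?thesis using that pullback_base[OF z, of n] by simp
  qed
  show near: "u = pullback z n (orbit 0 n u) \<or> exp (- 8) * total_scale z n \<le> cmod (u - z)" for n
  proof (induction n)
    case (Suc n)
    define p where "p = orbit 0 n z"
    have p: "cmod (step n p) \<le> 2" unfolding p_def by (rule norm_step_orb_le[OF z])
    have sc: "scale n p \<le> 1 / 2" "scale n p > 0"
      using scale_le_half[OF p] scale_pos[OF step_in_disc_imp(3)[OF p]] by auto
    from Suc show ?case
    proof
      assume "u = pullback z n (orbit 0 n u)"
      moreover have "exp (- 8) * total_scale z (Suc n) \<le> R n"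
      proof -
        have "scale n p = cmod p / real (N n) / cmod p ^ N n" by (simp add: scale_def)
        also have "\<dots> \<le> cmod p / real (N n) / 2"
          using step_in_disc_imp(1)[OF p] by (intro divide_left_mono) auto
        finally have "scale n p \<le> cmod p / (2 * real (N n))" by (simp add: mult.commute)
        then have "exp (- 8) * total_scale z n * scale n p \<le> exp (- 8) * total_scale z n * (cmod p / (2 * real (N n)))"
          using total_scale_pos[OF z, of n] by (intro mult_left_mono) auto
        then show ?thesis by (simp add: R_def total_scale_Suc p_def mult.assoc)
      qed
      ultimately show ?thesis using step[of n] by linarith
    next
      assume le: "exp (- 8) * total_scale z n \<le> cmod (u - z)"
      have "exp (- 8) * total_scale z (Suc n) \<le> exp (- 8) * total_scale z n"
        using sc total_scale_pos[OF z, of n] by (simp add: total_scale_Suc p_def mult_left_le)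
      then show ?thesis using le by linarith
    qed
  qed simp
  assume n: "n \<ge> 1"
  have "cmod (orbit 0 n z) / (2 * real (N n)) \<le> 2 / (2 * 1)"
    using norm_orb_le[OF z n] N_pos[of n] by (intro frac_le) auto
  then have "exp (- 8) * total_scale z n * (cmod (orbit 0 n z) / (2 * real (N n))) \<le> exp (- 8) * total_scale z n * 1"
    using total_scale_pos[OF z, of n] by (intro mult_left_mono) auto
  then have "R n \<le> exp (- 8) * total_scale z n" by (simp add: R_def)
  then show "u = pullback z (Suc n) (orbit 0 (Suc n) u) \<or> R n \<le> cmod (u - z)"
    using near[of n] step[of n] by linarith
qed

text \<open>At a block with large \<open>c k\<close>, the cylinder of the next level around \<open>z\<close>
  has size of order \<open>cmod p / (N * cmod p ^ N)\<close> in the coordinate at that block, with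
  \<open>p\<close> the image of \<open>z\<close>, and its neighbours have distance of order
  \<open>cmod p / N\<close>. The quotient is of order \<open>cmod p ^ N\<close>, that is
  \<open>cmod (c k)\<close>, up to the distortion \<open>exp 16\<close>.\<close>
lemma survivors_pointwise_thin:
  assumes unbdd: "\<And>B k0. \<exists>k\<ge>k0. cmod (c k) \<ge> B"
  shows "pointwise_thin (survivors 0)"
  unfolding pointwise_thin_def
proof
  fix z assume z: "z \<in> survivors 0"
  \<comment> \<open>The ratio of the radii below is \<open>cmod p ^ N / (8 * exp 16)\<close>, and \<open>cmod p ^ N \<ge> cmod (c k) - 2\<close>.\<close>
  define B where "B n = 2 + 8 * exp 16 * real (n + 2)" for n :: nat
  obtain k where k: "\<And>n. k n \<ge> Suc n" "\<And>n. cmod (c (k n)) \<ge> B n"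
  proof -
    have "\<forall>n. \<exists>k. Suc n \<le> k \<and> B n \<le> cmod (c k)" using unbdd by blast
    then show ?thesis using that by metis
  qed
  define r where "r n = 4 * exp 8 * total_scale z (Suc (k n))" for n
  define R where "R n = exp (- 8) * total_scale z (k n) * cmod (orbit 0 (k n) z) / (2 * real (N (k n)))" for n
  have r_pos: "r n > 0" for n using total_scale_pos[OF z] by (simp add: r_def)
  have ratio: "R n / r n \<ge> real (n + 2)" for n
  proof -
    define p where "p = orbit 0 (k n) z"
    have p: "cmod (step (k n) p) \<le> 2" unfolding p_def by (rule norm_step_orb_le[OF z])
    have p0: "p \<noteq> 0" by (rule step_in_disc_imp[OF p])
    have "8 * exp 16 * real (n + 2) \<le> cmod p ^ N (k n)"
      using norm_power_bounds(1)[OF p] k(2)[of n] by (simp add: B_def)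
    then have "8 * (exp 8 * exp 8) * real (n + 2) \<le> cmod p ^ N (k n)"
      by (simp add: mult_exp_exp)
    moreover have "R n / r n = cmod p ^ N (k n) / (8 * (exp 8 * exp 8))"
      using p0 total_scale_pos[OF z, of "k n"] N_pos[of "k n"]
      by (simp add: R_def r_def total_scale_Suc scale_def p_def exp_minus field_simps)
    ultimately show ?thesis by (simp add: pos_le_divide_eq mult_ac)
  qed
  have rR: "r n < R n" for n
  proof -
    have "1 < R n / r n" using ratio[of n] by simp
    then show ?thesis using r_pos[of n] by (simp add: less_divide_eq)
  qed
  have Rle: "R n \<le> (1 / 2) ^ n" for n
  proof -
    have k1: "k n \<ge> 1" using k(1)[of n] by simp
    have "cmod (orbit 0 (k n) z) / (2 * real (N (k n))) \<le> 2 / (2 * 1)"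
      using norm_orb_le[OF z k1] N_pos[of "k n"] by (intro frac_le) auto
    then have "exp (- 8) * total_scale z (k n) * (cmod (orbit 0 (k n) z) / (2 * real (N (k n)))) \<le> 1 * total_scale z (k n) * 1"
      using total_scale_pos[OF z, of "k n"] by (intro mult_mono) auto
    then have "R n \<le> total_scale z (k n)" by (simp add: R_def)
    also have "\<dots> \<le> (1 / 2) ^ k n" by (rule total_scale_le[OF z])
    also have "\<dots> \<le> (1 / 2) ^ n" using k(1)[of n] by (intro power_decreasing) auto
    finally show ?thesis .
  qed
  have sep: "separates (round_annulus z (r n) (R n)) (survivors 0)" for n
    unfolding separates_round_annulus_iff[OF r_pos rR]
  proof (intro conjI ballI)
    fix u assume u: "u \<in> survivors 0"
    have "u = pullback z (Suc (k n)) (orbit 0 (Suc (k n)) u) \<or> R n \<le> cmod (u - z)"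
      unfolding R_def by (rule gap_around_cylinder[OF z u]) (use k(1)[of n] in simp)
    moreover have "cmod (pullback z (Suc (k n)) (orbit 0 (Suc (k n)) u) - z) \<le> r n"
      unfolding r_def by (rule pullback_near[OF z]) (use norm_orb_le[OF u, of "Suc (k n)"] in auto)
    ultimately show "cmod (u - z) \<le> r n \<or> R n \<le> cmod (u - z)" by metis
  next
    show "\<exists>w\<in>survivors 0. cmod (w - z) \<le> r n" using z r_pos[of n] by (intro bexI[of _ z]) auto
    have "cmod z > 1" using step_in_disc_imp(2)[OF norm_step_orb_le[OF z, of 0]] by simp
    moreover have "cmod (- z - z) = 2 * cmod z"
    proof -
      have "- z - z = - 2 * z" by simp
      then show ?thesis by (simp only: norm_mult) simp
    qed
    moreover have "R n \<le> 1" using Rle[of n] power_le_one[of "1 / 2 :: real" n] by simp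
    ultimately have "R n \<le> cmod (- z - z)" by linarith
    then show "\<exists>w\<in>survivors 0. R n \<le> cmod (w - z)" using uminus_survivors[OF z] by blast
  qed
  have "R \<longlonglongrightarrow> 0"
  proof (rule tendsto_sandwich[of "\<lambda>_. 0" R sequentially "\<lambda>n. (1 / 2) ^ n"])
    show "\<forall>\<^sub>F n in sequentially. 0 \<le> R n"
      using r_pos rR by (intro always_eventually allI) (meson less_imp_le less_trans)
  qed (use Rle in \<open>auto intro!: LIMSEQ_power_zero\<close>)
  moreover have "filterlim (\<lambda>n. R n / r n) at_top sequentially"
    unfolding filterlim_at_top
  proof
    fix Z :: real
    have "\<forall>\<^sub>F n in sequentially. Z \<le> real n"
      using filterlim_real_sequentially unfolding filterlim_at_top by blast
    then show "\<forall>\<^sub>F n in sequentially. Z \<le> R n / r n"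
      by eventually_elim (use ratio in \<open>smt (verit) of_nat_add of_nat_0_le_iff\<close>)
  qed
  ultimately show "\<exists>r R :: nat \<Rightarrow> real.
        (\<forall>n. 0 < r n \<and> r n < R n \<and> separates (round_annulus z (r n) (R n)) (survivors 0)) \<and>
        filterlim (\<lambda>n. R n / r n) at_top sequentially \<and> R \<longlonglongrightarrow> 0"
    using r_pos rR sep by blast
qed

section \<open>Bounded parameters: uniformly perfect Julia sets\<close>

text \<open>Suppose \<open>X\<close> contains a cylinder, and rotate the cylinder by one \<open>N\<close>-th
  root of unity around 0 in the coordinate of its parent. The rotation moves a point \<open>q\<close> by at most
  \<open>2 * pi * cmod q / N\<close>. Since the survivors are symmetric under
  \<open>\<lambda>z. - z\<close>, the cylinder contains with the preimage \<open>q\<close> of \<open>v\<close>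
  also the preimage \<open>q'\<close> of \<open>- v\<close>, at a distance of at least a constant times
  \<open>cmod q / N\<close>; this is where the bound on \<open>c\<close> enters. If the rotated point were in
  \<open>Y\<close>, it would be too close to \<open>X\<close> for \<open>X\<close> to be isolated. So the
  rotated cylinders all lie in \<open>X\<close>, and they fill the parent. Small cylinders around a point of
  \<open>X\<close> do lie in \<open>X\<close>, because \<open>Y\<close> is closed; going up to level 0 shows
  that \<open>Y\<close> is empty.\<close>
lemma no_isolated_part:
  assumes bdd: "\<And>j. cmod (c j) \<le> b" and \<kappa>: "\<kappa> \<ge> 0" "\<kappa> * exp 16 * pi * (b + 2) < 1"
    and XY: "closed Y" "X \<union> Y = survivors 0" "X \<inter> Y = {}" "X \<noteq> {}" "Y \<noteq> {}"
    and iso: "\<And>x x' y. x \<in> X \<Longrightarrow> x' \<in> X \<Longrightarrow> y \<in> Y \<Longrightarrow> cmod (x - x') \<le> \<kappa> * cmod (x - y)"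
  shows False
proof -
  obtain a where aX: "a \<in> X" using XY(4) by blast
  then have a: "a \<in> survivors 0" using XY(2) by blast
  have cyl_sub: "pullback a n w \<in> X \<union> Y" if "w \<in> survivors n" for n w
    unfolding XY(2) by (rule pullback_in_survivors[OF a that])
  have descend: "pullback a n ` survivors n \<subseteq> X" if hyp: "pullback a (Suc n) ` survivors (Suc n) \<subseteq> X" for n
  proof -
    define p where "p = orbit 0 n a"
    have p: "cmod (step n p) \<le> 2" unfolding p_def by (rule norm_step_orb_le[OF a])
    have p0: "p \<noteq> 0" by (rule step_in_disc_imp[OF p])
    define \<omega> where "\<omega> = cis (2 * pi / real (N n))"
    have \<omega>: "\<omega> ^ N n = 1" "cmod \<omega> = 1"
      proof -
      have "real (N n) * (2 * pi / real (N n)) = 2 * pi" using N_pos[of n] by simp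
      then show "\<omega> ^ N n = 1" unfolding \<omega>_def Complex.DeMoivre by (metis cis_2pi)
    qed (simp add: \<omega>_def)
    have \<omega>1: "cmod (1 - \<omega>) \<le> 2 * pi / real (N n)"
    proof -
      have "cmod (1 - \<omega>) = 2 * \<bar>sin (2 * pi / real (N n) / 2)\<bar>"
        unfolding \<omega>_def norm_minus_commute[of 1] cis_conv_exp by (rule dist_exp_i_1)
      also have "\<dots> \<le> 2 * \<bar>2 * pi / real (N n) / 2\<bar>"
        by (intro mult_left_mono abs_sin_x_le_abs_x) auto
      finally show ?thesis by simp
    qed
    have br: "branch n p v \<in> survivors n" if "v \<in> survivors (Suc n)" for v
      unfolding p_def by (rule branch_in_survivors[OF a that])
    have rot: "\<omega> ^ i * q \<in> survivors n" if "q \<in> survivors n" for i q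
      using that \<omega>(1) by (intro rotate_survivors) (simp_all add: power_mult[symmetric] mult.commute[of i] power_mult)
    \<comment> \<open>The rotated cylinders lie in \<open>X\<close>, one after the other around the circle.\<close>
    have main: "pullback a n (\<omega> ^ i * branch n p v) \<in> X" if "v \<in> survivors (Suc n)" for i v
      using that
    proof (induction i arbitrary: v)
      case 0
      then have "pullback a (Suc n) v \<in> X" using hyp by blast
      then show ?case by (simp add: p_def)
    next
      case (Suc i)
      define q q' where "q = branch n p v" and "q' = branch n p (- v)"
      have v: "v \<in> survivors (Suc n)" "- v \<in> survivors (Suc n)" using Suc.prems uminus_survivors by auto
      have v2: "cmod v \<le> 2" "cmod (- v) \<le> 2" using norm_survivors_le_2[OF v(1)] by auto
      have q: "q \<in> survivors n" "q' \<in> survivors n" using br v by (auto simp: q_def q'_def)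
      have sq: "step n q = v" "step n q' = - v"
        unfolding q_def q'_def using step_branch[OF p0] v2 by blast+
      have v1: "cmod v > 1" using v(1) survivors_iff step_in_disc_imp(2) by blast
      show ?case
      proof (rule ccontr)
        assume "pullback a n (\<omega> ^ Suc i * branch n p v) \<notin> X"
        then have y: "pullback a n (\<omega> ^ Suc i * q) \<in> Y"
          using cyl_sub[OF rot[OF q(1)], of "Suc i"] by (auto simp: q_def)
        have x: "pullback a n (\<omega> ^ i * q) \<in> X" "pullback a n (\<omega> ^ i * q') \<in> X"
          using Suc.IH[OF v(1)] Suc.IH[OF v(2)] by (simp_all add: q_def q'_def)
        have in2: "cmod (\<omega> ^ i * q) \<le> 2" "cmod (\<omega> ^ i * q') \<le> 2" "cmod (\<omega> ^ Suc i * q) \<le> 2" if "n \<ge> 1"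
          using norm_survivors_le_2[OF rot that] q by blast+
        define t where "t = total_scale a n"
        have t: "t > 0" unfolding t_def by (rule total_scale_pos[OF a])
        have "t * exp (- 8) * cmod (\<omega> ^ i * q - \<omega> ^ i * q') \<le> cmod (pullback a n (\<omega> ^ i * q) - pullback a n (\<omega> ^ i * q'))"
          unfolding t_def by (rule pullback_bilipschitz[OF a]) (use in2 in auto)
        also have "\<dots> \<le> \<kappa> * cmod (pullback a n (\<omega> ^ i * q) - pullback a n (\<omega> ^ Suc i * q))"
          by (rule iso[OF x y])
        also have "\<dots> \<le> \<kappa> * (t * exp 8 * cmod (\<omega> ^ i * q - \<omega> ^ Suc i * q))"
          unfolding t_def by (intro mult_left_mono pullback_bilipschitz[OF a] \<kappa>(1)) (use in2 in auto)
        also have "cmod (\<omega> ^ i * q - \<omega> ^ i * q') = cmod (q - q')"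
          unfolding right_diff_distrib[symmetric] norm_mult norm_power by (simp add: \<omega>(2))
        also have "\<omega> ^ i * q - \<omega> ^ Suc i * q = \<omega> ^ i * (q * (1 - \<omega>))"
          by (simp add: algebra_simps)
        also have "cmod (\<omega> ^ i * (q * (1 - \<omega>))) = cmod q * cmod (1 - \<omega>)"
          unfolding norm_mult norm_power by (simp add: \<omega>(2))
        finally have "t * (exp (- 8) * cmod (q - q')) \<le> t * (\<kappa> * exp 8 * cmod q * cmod (1 - \<omega>))"
          by (simp add: mult_ac)
        then have "exp (- 8) * cmod (q - q') \<le> \<kappa> * exp 8 * cmod q * cmod (1 - \<omega>)"
          using t by (simp only: mult_le_cancel_left_pos)
        then have "exp 8 * (exp (- 8) * cmod (q - q')) \<le> exp 8 * (\<kappa> * exp 8 * cmod q * cmod (1 - \<omega>))"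
          by (intro mult_left_mono) auto
        also have "exp 8 * (exp (- 8) * cmod (q - q')) = cmod (q - q')"
          by (simp add: exp_minus)
        also have "exp 8 * (\<kappa> * exp 8 * cmod q * cmod (1 - \<omega>)) = \<kappa> * exp 16 * cmod q * cmod (1 - \<omega>)"
          using exp_add[of "8::real" 8] by (simp add: mult_ac)
        also have "\<dots> \<le> \<kappa> * exp 16 * cmod q * (2 * pi / real (N n))"
          using \<omega>1 \<kappa>(1) by (intro mult_left_mono) auto
        finally have up: "cmod (q - q') \<le> \<kappa> * exp 16 * cmod q * (2 * pi / real (N n))" .

        have q1: "cmod q > 1" "cmod q' > 1"
          using step_in_disc_imp(2)[of n q] step_in_disc_imp(2)[of n q'] sq v2 by auto
        define M where "M = max (cmod q) (cmod q')"
        have M: "cmod q \<le> M" "cmod q' \<le> M" "M > 0" using q1 by (auto simp: M_def)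
        have "cmod q ^ N n \<le> b + 2" "cmod q' ^ N n \<le> b + 2"
          using norm_power_bounds(2)[of n q] norm_power_bounds(2)[of n q'] sq v2 bdd[of n] by auto
        then have MN: "M ^ N n \<le> b + 2" by (simp add: M_def max_def)
        have "b \<ge> 0" using bdd[of 0] norm_ge_zero order_trans by blast
        have "q ^ N n = v - c n" "q' ^ N n = - v - c n"
          using sq by (simp_all add: step_def eq_diff_eq)
        then have "v - - v = q ^ N n - q' ^ N n" by simp
        then have "cmod (2 * v) = cmod (q ^ N n - q' ^ N n)" by simp
        also have "\<dots> \<le> real (N n) * M ^ (N n - 1) * cmod (q - q')"
          by (rule norm_power_diff_le[OF M(1,2)])
        also have "M ^ (N n - 1) = M ^ N n / M" by (rule power_pred) (use M(3) in simp)
        also have "real (N n) * (M ^ N n / M) * cmod (q - q') \<le> real (N n) * ((b + 2) / cmod q) * cmod (q - q')"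
          using MN M q1 \<open>b \<ge> 0\<close> by (intro mult_right_mono mult_left_mono frac_le) auto
        also have "\<dots> \<le> real (N n) * ((b + 2) / cmod q) * (\<kappa> * exp 16 * cmod q * (2 * pi / real (N n)))"
          using up q1 \<open>b \<ge> 0\<close> by (intro mult_left_mono) auto
        also have "\<dots> = 2 * (\<kappa> * exp 16 * pi * (b + 2))"
        proof -
          have "cmod q \<noteq> 0" "real (N n) \<noteq> 0" using q1 N_pos[of n] by auto
          then show ?thesis by (simp add: field_simps)
        qed
        also have "\<dots> < 2" using \<kappa>(2) by simp
        finally show False using v1 by (simp add: norm_mult)
      qed
    qed
    show ?thesis
    proof
      fix x assume "x \<in> pullback a n ` survivors n"
      then obtain w where w: "w \<in> survivors n" "x = pullback a n w" by blast
      define q where "q = branch n p (step n w)"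
      have sw: "step n w \<in> survivors (Suc n)" "cmod (step n w) \<le> 2" using w(1) survivors_iff by blast+
      have w0: "w \<noteq> 0" by (rule step_in_disc_imp[OF sw(2)])
      have "step n q = step n w" unfolding q_def by (rule step_branch[OF p0 sw(2)])
      then have qw: "q ^ N n = w ^ N n" by (simp add: step_def)
      then have q0: "q \<noteq> 0" using w0 N_pos[of n] by (metis power_eq_0_iff)
      have "(w / q) ^ N n = 1" using qw w0 by (simp add: power_divide)
      then obtain i where "w / q = cis (2 * pi * real i / real (N n))"
        using Complex.bij_betw_roots_unity[OF N_pos[of n]] unfolding bij_betw_def by blast
      also have "\<dots> = \<omega> ^ i" unfolding \<omega>_def Complex.DeMoivre by (simp add: mult_ac)
      finally have "w = \<omega> ^ i * q" using q0 by (simp add: field_simps)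
      then show "x \<in> X" using main[OF sw(1), of i] w(2) by (simp add: q_def)
    qed
  qed
  have "a \<in> - Y" using aX XY(3) by blast
  then obtain \<epsilon> where \<epsilon>: "\<epsilon> > 0" "ball a \<epsilon> \<subseteq> - Y"
    using XY(1) by (metis open_Compl open_contains_ball)
  obtain n where n: "n \<ge> 1" "\<And>w. cmod w \<le> 2 \<Longrightarrow> cmod (pullback a n w - a) < \<epsilon>"
    using pullback_eventually_near[OF a \<epsilon>(1)] by blast
  have "pullback a n ` survivors n \<subseteq> X"
  proof
    fix x assume "x \<in> pullback a n ` survivors n"
    then obtain w where w: "w \<in> survivors n" "x = pullback a n w" by blast
    have "cmod (x - a) < \<epsilon>" unfolding w(2) by (rule n(2)[OF norm_survivors_le_2[OF w(1) n(1)]])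
    then have "x \<notin> Y" using \<epsilon>(2) by (auto simp: dist_norm norm_minus_commute)
    then show "x \<in> X" using cyl_sub[OF w(1)] w(2) by blast
  qed
  then have "pullback a 0 ` survivors 0 \<subseteq> X"
    by (induction n) (use descend in auto)
  then show False using XY by auto
qed

lemma survivors_uniformly_perfect:
  assumes bdd: "\<And>j. cmod (c j) \<le> b"
  shows "uniformly_perfect (survivors 0)"
proof -
  have b: "b > 4" using bdd[of 0] c_large[of 0] by linarith
  define \<kappa> where "\<kappa> = 1 / (2 * exp 16 * pi * (b + 2))"
  have \<kappa>: "\<kappa> > 0" "\<kappa> * exp 16 * pi * (b + 2) < 1" using b by (simp_all add: \<kappa>_def)
  show ?thesis
  proof (rule uniformly_perfect_criterion[OF compact_survivors survivors_two_points \<kappa>(1)])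
    fix X Y assume XY: "closed Y" "X \<union> Y = survivors 0" "X \<inter> Y = {}" "X \<noteq> {}" "Y \<noteq> {}"
      "\<And>x x' y. x \<in> X \<Longrightarrow> x' \<in> X \<Longrightarrow> y \<in> Y \<Longrightarrow> cmod (x - x') \<le> \<kappa> * cmod (x - y)"
    show False
      by (rule no_isolated_part[OF bdd less_imp_le[OF \<kappa>(1)] \<kappa>(2) XY(1-5)]) (rule XY(6))
  qed
qed

end

section \<open>Normality\<close>

text \<open>A sequence taken from a uniformly convergent one either repeats one member infinitely often or has
  indices that tend to infinity.\<close>
lemma normal_on_range_if_uniform_limit:
  assumes "uniform_limit U F l sequentially"
  shows "normal_on (range F) U"
  unfolding normal_on_def
proof (intro allI impI)
  fix g :: "nat \<Rightarrow> riemann_sphere \<Rightarrow> riemann_sphere" assume "range g \<subseteq> range F"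
  then have "\<forall>n. \<exists>i. g n = F i" by blast
  then obtain ix where ix: "\<And>n. g n = F (ix n)" by metis
  show "\<exists>s l. strict_mono (s :: nat \<Rightarrow> nat) \<and>
           (\<forall>K. compact K \<and> K \<subseteq> U \<longrightarrow> uniform_limit K (\<lambda>n. g (s n)) l sequentially)"
  proof (cases "\<exists>v. infinite {n. ix n = v}")
    case True
    then obtain v where v: "infinite {n. ix n = v}" by blast
    define s where "s = enumerate {n. ix n = v}"
    have "strict_mono s" unfolding s_def by (rule strict_mono_enumerate[OF v])
    moreover have "g (s n) = F v" for n
      using enumerate_in_set[OF v, of n] by (simp add: s_def ix)
    then have "uniform_limit K (\<lambda>n. g (s n)) (F v) sequentially" for K
      by (simp add: uniform_limit_const)
    ultimately show ?thesis by blast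
  next
    case False
    have "filterlim ix at_top sequentially"
      unfolding filterlim_at_top
    proof
      fix Z
      have "{n. \<not> Z \<le> ix n} = (\<Union>v<Z. {n. ix n = v})" by auto
      then have "finite {n. \<not> Z \<le> ix n}" using False by simp
      then show "\<forall>\<^sub>F n in sequentially. Z \<le> ix n"
        by (simp add: eventually_cofinite flip: cofinite_eq_sequentially)
    qed
    then have "uniform_limit U (\<lambda>n. F (ix n)) l sequentially"
      by (rule filterlim_compose[OF assms])
    then have "\<forall>K. compact K \<and> K \<subseteq> U \<longrightarrow> uniform_limit K (\<lambda>n. g (id n)) l sequentially"
      by (auto simp: ix intro: uniform_limit_on_subset)
    then show ?thesis using strict_mono_id by blast
  qed
qed

lemma escaping_neighbourhood_in_Fatou:
  assumes U: "open U" "z \<in> U"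
    and esc: "\<And>B. \<exists>n0. \<forall>n\<ge>n0. \<forall>x. Plane x \<in> U \<longrightarrow> cmod (compose_range P m n x) \<ge> B"
  shows "z \<in> iterated_Fatou P m"
proof -
  define F where "F i = sphere_ext (compose_range P m (m + i))" for i
  have "uniform_limit U F (\<lambda>_. Infty) sequentially"
  proof (rule uniform_limitI)
    fix e :: real assume e: "e > 0"
    obtain n0 where n0: "\<And>n x. n \<ge> n0 \<Longrightarrow> Plane x \<in> U \<Longrightarrow> cmod (compose_range P m n x) \<ge> 4 / e"
      using esc by blast
    have "dist (F n y) Infty < e" if "n \<ge> n0" "y \<in> U" for n y
    proof (cases y)
      case (Plane x)
      define w where "w = compose_range P m (m + n) x"
      have w: "cmod w \<ge> 4 / e" unfolding w_def using that Plane by (intro n0) auto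
      moreover have "4 / e > 0" using e by simp
      ultimately have w0: "cmod w > 0" by linarith
      have "dist (Plane w) Infty \<le> 2 / cmod w" using w0 by (intro dist_Plane_Infty_le) auto
      also have "\<dots> < e" using w w0 e by (simp add: field_simps)
      finally show ?thesis by (simp add: F_def Plane w_def)
    qed (use e in \<open>simp add: F_def\<close>)
    then show "\<forall>\<^sub>F n in sequentially. \<forall>y\<in>U. dist (F n y) Infty < e"
      unfolding eventually_sequentially by blast
  qed
  then have "normal_on (range F) U" by (rule normal_on_range_if_uniform_limit)
  moreover have "range F = {sphere_ext (compose_range P m n) | n. m \<le> n}"
    unfolding F_def by (auto simp: le_iff_add)
  ultimately show ?thesis using U by (auto simp: iterated_Fatou_def)
qed

text \<open>A locally uniform limit would be \<open>Infty\<close> at points arbitrarily close to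
  \<open>z\<close>, while the maps stay bounded at \<open>z\<close>. One map that is close to the limit on a
  compact disc around \<open>z\<close> violates continuity there.\<close>
lemma accumulated_by_escaping_not_in_Fatou:
  assumes cont: "\<And>n. continuous_on UNIV (compose_range P m n)"
    and idx: "\<And>j. idx j \<ge> m"
    and bdd: "\<And>j. cmod (compose_range P m (idx j) z) \<le> 2"
    and esc: "\<And>\<epsilon>. \<epsilon> > 0 \<Longrightarrow> \<exists>x. cmod (x - z) < \<epsilon> \<and>
       filterlim (\<lambda>j. cmod (compose_range P m (idx j) x)) at_top sequentially"
  shows "Plane z \<notin> iterated_Fatou P m"
proof
  assume "Plane z \<in> iterated_Fatou P m"
  then obtain U where U: "open U" "Plane z \<in> U"
    and norm: "normal_on {sphere_ext (compose_range P m n) | n. m \<le> n} U"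
    by (auto simp: iterated_Fatou_def)
  have "open (Plane -` U)"
    using U(1) continuous_on_Plane[of UNIV] by (rule open_vimage)
  then obtain r where r: "r > 0" "cball z r \<subseteq> Plane -` U"
    using U(2) by (metis open_contains_cball vimageI)
  define g where "g j = sphere_ext (compose_range P m (idx j))" for j
  have "range g \<subseteq> {sphere_ext (compose_range P m n) | n. m \<le> n}"
    using idx by (auto simp: g_def)
  then have "\<exists>s l. strict_mono s \<and>
      (\<forall>K. compact K \<and> K \<subseteq> U \<longrightarrow> uniform_limit K (\<lambda>n. g (s n)) l sequentially)"
    by (rule norm[unfolded normal_on_def, rule_format])
  then obtain s l where s: "strict_mono s"
    and lim: "\<And>K. compact K \<Longrightarrow> K \<subseteq> U \<Longrightarrow> uniform_limit K (\<lambda>n. g (s n)) l sequentially"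
    by blast
  define K where "K = Plane ` cball z r"
  have K: "uniform_limit K (\<lambda>n. g (s n)) l sequentially"
    using r(2) by (intro lim) (auto simp: K_def intro: compact_image_Plane)
  obtain n where n: "\<And>y. y \<in> K \<Longrightarrow> dist (g (s n) y) (l y) < 1 / 4"
    using uniform_limitD[OF K, of "1 / 4"] unfolding eventually_sequentially by auto
  define Q where "Q = compose_range P m (idx (s n))"
  have "isCont Q z" using cont[of "idx (s n)"] by (simp add: Q_def continuous_on_eq_continuous_at)
  then obtain \<delta> where \<delta>: "\<delta> > 0" "\<And>x. dist x z < \<delta> \<Longrightarrow> dist (Q x) (Q z) < 1"
    unfolding continuous_at_eps_delta by (metis zero_less_one)
  obtain x where x: "cmod (x - z) < min \<delta> r"
    and xlim: "filterlim (\<lambda>j. cmod (compose_range P m (idx j) x)) at_top sequentially"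
    using esc[of "min \<delta> r"] \<delta>(1) r(1) by auto
  have xK: "Plane x \<in> K" using x by (auto simp: K_def dist_norm norm_minus_commute)
  have "(\<lambda>j. g (s j) (Plane x)) \<longlonglongrightarrow> l (Plane x)"
    by (rule tendsto_uniform_limitI[OF K xK])
  moreover have "(\<lambda>j. g (s j) (Plane x)) \<longlonglongrightarrow> Infty"
  proof (rule metric_tendsto_imp_tendsto)
    have lim_x: "filterlim (\<lambda>j. cmod (compose_range P m (idx (s j)) x)) at_top sequentially"
      by (rule filterlim_compose[OF xlim filterlim_subseq[OF s]])
    then show "(\<lambda>j. 2 / cmod (compose_range P m (idx (s j)) x)) \<longlonglongrightarrow> 0"
      by (rule real_tendsto_divide_at_top[OF tendsto_const])
    show "\<forall>\<^sub>F j in sequentially. dist (g (s j) (Plane x)) Infty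
            \<le> dist (2 / cmod (compose_range P m (idx (s j)) x)) 0"
    proof -
      have "\<forall>\<^sub>F j in sequentially. 0 < cmod (compose_range P m (idx (s j)) x)"
        using lim_x unfolding filterlim_at_top_dense by blast
      then show ?thesis
        by eventually_elim (use dist_Plane_Infty_le in \<open>simp add: g_def\<close>)
    qed
  qed
  ultimately have "l (Plane x) = Infty" by (rule LIMSEQ_unique)
  then have "dist (Plane (Q x)) Infty < 1 / 4" using n[OF xK] by (simp add: g_def Q_def)
  moreover have "cmod (Q x) \<le> 3"
    using \<delta>(2)[of x] x bdd[of "s n"] norm_triangle_ineq2[of "Q x" "Q z"] by (simp add: dist_norm Q_def)
  then have "(cmod (Q x))\<^sup>2 \<le> 3\<^sup>2" by (intro power_mono) auto
  then have "sqrt (1 + (cmod (Q x))\<^sup>2) \<le> sqrt 16" by (intro real_sqrt_le_mono) simp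
  then have "2 / 4 \<le> 2 / sqrt (1 + (cmod (Q x))\<^sup>2)"
    by (intro divide_left_mono mult_pos_pos real_sqrt_gt_zero add_pos_nonneg) auto
  ultimately show False by (simp add: dist_Plane_Infty)
qed

section \<open>Blocks of the quadratic sequence\<close>

lemma compose_range_same: "compose_range P m m z = z"
  by (simp add: compose_range_def)

lemma compose_range_Suc:
  "m \<le> n \<Longrightarrow> compose_range P m (Suc n) z = P (Suc n) (compose_range P m n z)"
  by (simp add: compose_range_def)

lemma block_end_0: "block_end d 0 = 0"
  by (simp add: block_end_def)

lemma block_end_Suc: "block_end d (Suc k) = block_end d k + d (Suc k) + 1"
  by (simp add: block_end_def)

lemma strict_mono_block_end: "strict_mono (block_end d)"
  by (rule strict_monoI_Suc) (simp add: block_end_Suc)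

lemma quad_seq_block_end:
  assumes "k \<ge> 1"
  shows "quad_seq c d (block_end d k) z = z\<^sup>2 + c k"
proof -
  have eq: "block_end d k = block_end d j \<longleftrightarrow> j = k" for j
    using strict_mono_eq[OF strict_mono_block_end, of d k j] by auto
  show ?thesis
  proof -
    have "(THE j. j \<ge> 1 \<and> j = k) = k" by (rule the_equality) (use assms in auto)
    then show ?thesis using assms unfolding quad_seq_def eq by auto
  qed
qed

lemma quad_seq_inside_block:
  assumes "block_end d k < n" "n < block_end d (Suc k)"
  shows "quad_seq c d n z = z\<^sup>2"
proof -
  have "n \<noteq> block_end d j" for j
    using assms strict_mono_less[OF strict_mono_block_end, of d] by (metis not_less_eq)
  then show ?thesis by (simp add: quad_seq_def)
qed

lemma continuous_quad_seq: "continuous_on S (quad_seq c d n)"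
proof -
  have "\<exists>b. quad_seq c d n = (\<lambda>z. z\<^sup>2 + b)"
    by (rule exI[of _ "if \<exists>k\<ge>1. n = block_end d k then c (THE k. k \<ge> 1 \<and> n = block_end d k) else 0"])
       (auto simp: quad_seq_def fun_eq_iff)
  then show ?thesis by (auto intro!: continuous_intros)
qed

lemma compose_inside_block:
  assumes "m \<le> n" "block_end d k \<le> n" "n + i < block_end d (Suc k)"
  shows "compose_range (quad_seq c d) m (n + i) z = compose_range (quad_seq c d) m n z ^ 2 ^ i"
  using assms(3)
proof (induction i)
  case (Suc i)
  have "compose_range (quad_seq c d) m (Suc (n + i)) z = (compose_range (quad_seq c d) m (n + i) z)\<^sup>2"
    using Suc.prems assms(1,2) by (simp add: compose_range_Suc quad_seq_inside_block[of d k])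
  then show ?case using Suc by (simp add: power_mult[symmetric] mult.commute)
qed simp

lemma compose_to_block_end:
  assumes "m \<le> n" "block_end d k \<le> n" "n < block_end d (Suc k)"
  shows "compose_range (quad_seq c d) m (block_end d (Suc k)) z =
    compose_range (quad_seq c d) m n z ^ 2 ^ (block_end d (Suc k) - n) + c (Suc k)"
proof -
  obtain i where i: "block_end d (Suc k) = Suc (n + i)"
    using assms(3) less_iff_Suc_add by metis
  have "compose_range (quad_seq c d) m (block_end d (Suc k)) z
      = quad_seq c d (block_end d (Suc k)) (compose_range (quad_seq c d) m (n + i) z)"
    using assms(1) by (simp add: i compose_range_Suc)
  also have "\<dots> = (compose_range (quad_seq c d) m (n + i) z)\<^sup>2 + c (Suc k)"
    by (rule quad_seq_block_end) simp
  also have "compose_range (quad_seq c d) m (n + i) z = compose_range (quad_seq c d) m n z ^ 2 ^ i"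
    by (rule compose_inside_block[OF assms(1,2)]) (simp add: i)
  finally show ?thesis by (simp add: i power_mult[symmetric] mult.commute)
qed

lemma between_block_ends:
  assumes "block_end d k \<le> n"
  obtains j where "j \<ge> k" "block_end d j \<le> n" "n < block_end d (Suc j)"
proof -
  define S where "S = {j. block_end d j \<le> n}"
  have "S \<subseteq> {..n}"
    using strict_mono_imp_increasing[OF strict_mono_block_end[of d]] order_trans by (fastforce simp: S_def)
  then have fin: "finite S" by (rule finite_subset) simp
  have k: "k \<in> S" using assms by (simp add: S_def)
  have "Max S \<in> S" using Max_in[OF fin] k by blast
  moreover have "Suc (Max S) \<notin> S" using Max_ge[OF fin, of "Suc (Max S)"] by auto
  ultimately show ?thesis using that[of "Max S"] Max_ge[OF fin k] by (simp add: S_def)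
qed

text \<open>The first block consists of the maps with index from \<open>m + 1\<close> to the next block end
  \<open>M\<close>, which compose to \<open>z ^ 2 ^ (M - m) + c\<close>. A point that is outside the
  disc of radius 2 at one block end escapes, uniformly on a neighbourhood, and belongs to the Fatou set; such
  points accumulate at every survivor.\<close>
lemma iterated_Julia_eq_survivors:
  fixes c :: "nat \<Rightarrow> complex" and d :: "nat \<Rightarrow> nat"
  assumes c4: "\<forall>k\<ge>1. cmod (c k) > 4"
    and dc: "\<forall>k\<ge>1. (2::real) ^ (2 ^ d k) \<ge> 2 * sqrt (cmod (c k))"
  obtains N K where "K \<ge> 1" "block_maps N (\<lambda>j. c (K + j))"
    "iterated_Julia (quad_seq c d) m = Plane ` block_maps.survivors N (\<lambda>j. c (K + j)) 0"
proof -
  define P where "P = quad_seq c d"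
  obtain K' where K': "block_end d K' \<le> m" "m < block_end d (Suc K')"
    using between_block_ends[of d 0 m] by (auto simp: block_end_0)
  define K where "K = Suc K'"
  define N :: "nat \<Rightarrow> nat" where
    "N j = 2 ^ (if j = 0 then block_end d K - m else d (K + j) + 1)" for j
  define c' where "c' j = c (K + j)" for j
  have N0: "N 0 = 2 ^ (block_end d K - m)"
    and N_Suc: "N (Suc j) = 2 ^ (d (Suc (K + j)) + 1)" for j
    by (simp_all add: N_def)
  interpret block_maps N c'
  proof
    fix j
    show "even (N j)" "0 < N j" using K'(2) by (auto simp: N_def K_def)
    show "cmod (c' j) > 4" using c4 by (simp add: c'_def K_def)
    assume "j \<ge> 1"
    then have N: "N j = 2 ^ d (K + j) * 2" by (simp add: N_def)
    have "2 * sqrt (cmod (c' j)) \<le> (2::real) ^ (2 ^ d (K + j))"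
      using dc by (simp add: c'_def K_def)
    then have "(2 * sqrt (cmod (c' j)))\<^sup>2 \<le> ((2::real) ^ (2 ^ d (K + j)))\<^sup>2"
      by (intro power_mono) auto
    then show "4 * cmod (c' j) \<le> 2 ^ N j"
      by (simp add: N power_mult power_mult_distrib)
  qed
  define E where "E j = block_end d (K + j)" for j
  have Emono: "strict_mono E"
    using strict_mono_block_end[of d] by (simp add: E_def strict_mono_def)
  have Em: "E j > m" for j
    using K'(2) strict_mono_leD[OF strict_mono_block_end, of K "K + j" d] by (simp add: E_def K_def)
  have orbE: "compose_range P m (E j) z = orbit 0 (Suc j) z" for j z
  proof (induction j)
    case 0
    show ?case
      using compose_to_block_end[OF order_refl K', of c z] c'_def[of 0]
      by (simp add: E_def K_def P_def compose_range_same step_def N0)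
  next
    case (Suc j)
    have "compose_range P m (block_end d (Suc (K + j))) z =
        compose_range P m (E j) z ^ 2 ^ (block_end d (Suc (K + j)) - E j) + c (Suc (K + j))"
      unfolding P_def using Em[of j] by (intro compose_to_block_end) (auto simp: E_def block_end_Suc)
    then show ?case
      using Suc c'_def[of "Suc j"] by (simp add: E_def block_end_Suc step_def N_Suc)
  qed
  have grow: "cmod (compose_range P m n z) \<ge> 2 ^ Suc i"
    if start: "cmod (orbit 0 (Suc j) z) \<ge> 2" and n: "n \<ge> E (j + i)" for n i j z
  proof -
    obtain k where k: "k \<ge> K + (j + i)" "block_end d k \<le> n" "n < block_end d (Suc k)"
      using between_block_ends[of d "K + (j + i)" n] n by (auto simp: E_def)
    define l where "l = k - K - j"
    have kl: "k = K + (j + l)" "l \<ge> i" using k(1) by (auto simp: l_def)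
    have "cmod (orbit 0 (Suc j + l) z) \<ge> 2 ^ Suc l"
      by (rule escape_orb[OF start]) simp
    then have big: "cmod (compose_range P m (E (j + l)) z) \<ge> 2 ^ Suc l"
      by (simp only: orbE add_Suc)
    obtain a where a: "n = E (j + l) + a" using k(2) kl(1) by (auto simp: E_def le_iff_add)
    have "compose_range P m n z = compose_range P m (E (j + l)) z ^ 2 ^ a"
      unfolding a P_def using Em[of "j + l"] k(3) a
      by (intro compose_inside_block[of _ _ d k]) (auto simp: kl E_def)
    then have "cmod (compose_range P m n z) = cmod (compose_range P m (E (j + l)) z) ^ 2 ^ a"
      by (simp add: norm_power)
    moreover have "(1::real) \<le> 2 ^ Suc l" by (rule one_le_power) simp
    ultimately have "cmod (compose_range P m n z) \<ge> 2 ^ Suc l"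
      using big self_le_power[of "cmod (compose_range P m (E (j + l)) z)" "2 ^ a"] by simp
    moreover have "(2::real) ^ Suc i \<le> 2 ^ Suc l" using kl(2) by (intro power_increasing) auto
    ultimately show ?thesis by linarith
  qed
  have unbdd: "\<exists>i. (2::real) ^ Suc i \<ge> B" for B
  proof -
    obtain i where "B < 2 ^ i" using real_arch_pow[of 2 B] by auto
    moreover have "(2::real) ^ i \<le> 2 ^ Suc i" by simp
    ultimately show ?thesis by (intro exI[of _ i]) linarith
  qed
  have cont: "continuous_on UNIV (compose_range P m n)" for n
  proof (cases "m \<le> n")
    case True
    then show ?thesis
    proof (induction n rule: dec_induct)
      case (step n)
      have "compose_range P m (Suc n) = (\<lambda>z. P (Suc n) (compose_range P m n z))"
        using step by (auto simp: compose_range_Suc)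
      moreover have "continuous_on UNIV (\<lambda>z. P (Suc n) (compose_range P m n z))"
        unfolding P_def
        by (rule continuous_on_compose2[OF continuous_quad_seq[of UNIV] step.IH[unfolded P_def]]) simp
      ultimately show ?case by simp
    qed (simp add: compose_range_same)
  qed (simp add: compose_range_def id_def)

  have julia: "Plane z \<notin> iterated_Fatou P m" if z: "z \<in> survivors 0" for z
  proof (rule accumulated_by_escaping_not_in_Fatou[of P m E])
    show "E j \<ge> m" for j using Em[of j] by simp
    show "cmod (compose_range P m (E j) z) \<le> 2" for j
      using z unfolding orbE survivors_def by blast
    fix \<epsilon> :: real assume "\<epsilon> > 0"
    then obtain x n where x: "cmod (x - z) < \<epsilon>" "n \<ge> 1" "cmod (orbit 0 n x) = 2"
      using escaping_points_near[OF z] by blast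
    then obtain n' where n': "n = Suc n'" by (cases n) auto
    have "filterlim (\<lambda>j. cmod (compose_range P m (E j) x)) at_top sequentially"
      unfolding filterlim_at_top
    proof
      fix B :: real
      obtain i where i: "(2::real) ^ Suc i \<ge> B" using unbdd by blast
      have "B \<le> cmod (compose_range P m (E j) x)" if "j \<ge> n' + i" for j
      proof -
        have "E (n' + i) \<le> E j" using that by (rule strict_mono_leD[OF Emono])
        then have "cmod (compose_range P m (E j) x) \<ge> 2 ^ Suc i"
          using x(3) n' by (intro grow[of n']) auto
        then show ?thesis using i by linarith
      qed
      then show "\<forall>\<^sub>F j in sequentially. B \<le> cmod (compose_range P m (E j) x)"
        unfolding eventually_sequentially by blast
    qed
    then show "\<exists>x. cmod (x - z) < \<epsilon> \<and>
       filterlim (\<lambda>j. cmod (compose_range P m (E j) x)) at_top sequentially"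
      using x(1) by blast
  qed (rule cont)
  have fatou: "y \<in> iterated_Fatou P m"
    if "open U" "y \<in> U" "\<And>x. Plane x \<in> U \<Longrightarrow> cmod (orbit 0 (Suc j) x) \<ge> 2" for y U j
  proof (rule escaping_neighbourhood_in_Fatou[OF that(1,2)])
    fix B
    obtain i where i: "(2::real) ^ Suc i \<ge> B" using unbdd by blast
    then show "\<exists>n0. \<forall>n\<ge>n0. \<forall>x. Plane x \<in> U \<longrightarrow> B \<le> cmod (compose_range P m n x)"
      using grow that(3) order_trans by (intro exI[of _ "E (j + i)"]) blast
  qed
  have "iterated_Julia P m = Plane ` survivors 0"
  proof (intro set_eqI iffI)
    fix y assume "y \<in> iterated_Julia P m"
    then have y: "y \<notin> iterated_Fatou P m" by (simp add: iterated_Julia_def)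
    show "y \<in> Plane ` survivors 0"
    proof (cases y)
      case (Plane z)
      have "z \<in> survivors 0"
      proof (rule ccontr)
        assume "z \<notin> survivors 0"
        then obtain j where j: "cmod (orbit 0 (Suc j) z) > 2"
          unfolding survivors_def mem_Collect_eq not_all not_le by blast
        define S where "S = {x. 2 < cmod (orbit 0 (Suc j) x)}"
        have "open S"
          unfolding S_def by (intro open_Collect_less continuous_intros continuous_orb)
        then have "y \<in> iterated_Fatou P m"
          using j by (intro fatou[OF open_image_Plane, of S y j]) (auto simp: S_def Plane)
        with y show False by contradiction
      qed
      then show ?thesis using Plane by blast
    next
      case Infty
      define R where "R = cmod (c' 0) + 2"
      have "y \<in> iterated_Fatou P m"
      proof (rule fatou[OF open_neighbourhood_Infty[of R], of y 0])
        fix x assume "Plane x \<in> insert Infty (Plane ` (- cball 0 R))"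
        then have "cmod x > R" by auto
        then show "cmod (orbit 0 (Suc 0) x) \<ge> 2"
          using norm_le_of_step[of x] by (cases "cmod (step 0 x) \<le> 2") (auto simp: R_def)
      qed (simp add: Infty)
      with y show ?thesis by contradiction
    qed
  next
    fix y assume "y \<in> Plane ` survivors 0"
    then show "y \<in> iterated_Julia P m" using julia by (auto simp: iterated_Julia_def)
  qed
  moreover have "c' = (\<lambda>j. c (K + j))" by (simp add: c'_def fun_eq_iff)
  ultimately show ?thesis
    using that[of K N] block_maps_axioms by (simp add: K_def P_def)
qed

section \<open>The dichotomy\<close>

lemma in_plane_image_iff: "in_plane \<Phi> (Plane ` S) \<longleftrightarrow> \<Phi> S"
  by (simp add: in_plane_def inj_image_eq_iff[OF inj_Plane])

theorem theorem1p6: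
  fixes c :: "nat \<Rightarrow> complex" and d :: "nat \<Rightarrow> nat"
  assumes "\<forall>k\<ge>1. cmod (c k) > 4"
    and "\<forall>k\<ge>1. d k > 0"
    and "\<forall>k\<ge>1. (2::real) ^ (2 ^ d k) \<ge> 2 * sqrt (cmod (c k))"
  shows "((\<forall>m. in_plane uniformly_perfect (iterated_Julia (quad_seq c d) m))
            \<longleftrightarrow> bounded (c ` {1..})) \<and>
         ((\<forall>m. in_plane (\<lambda>J. pointwise_thin J \<and> HNUP J) (iterated_Julia (quad_seq c d) m))
            \<longleftrightarrow> \<not> bounded (c ` {1..}))"
proof -
  let ?J = "iterated_Julia (quad_seq c d)"
  let ?thin = "\<lambda>J. pointwise_thin J \<and> HNUP J"
  have up: "in_plane uniformly_perfect (?J m)" if bdd: "bounded (c ` {1..})" for m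
  proof -
    obtain N K where K: "K \<ge> 1" "block_maps N (\<lambda>j. c (K + j))"
      "?J m = Plane ` block_maps.survivors N (\<lambda>j. c (K + j)) 0"
      by (rule iterated_Julia_eq_survivors[OF assms(1,3)])
    interpret block_maps N "\<lambda>j. c (K + j)" by (rule K(2))
    obtain b where "\<And>k. k \<ge> 1 \<Longrightarrow> cmod (c k) \<le> b"
      using bdd unfolding bounded_iff by auto
    then have "cmod (c (K + j)) \<le> b" for j using K(1) by simp
    then show ?thesis
      unfolding K(3) in_plane_image_iff by (rule survivors_uniformly_perfect)
  qed
  have thin: "in_plane ?thin (?J m)" if unbdd: "\<not> bounded (c ` {1..})" for m
  proof -
    obtain N K where K: "K \<ge> 1" "block_maps N (\<lambda>j. c (K + j))"
      "?J m = Plane ` block_maps.survivors N (\<lambda>j. c (K + j)) 0"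
      by (rule iterated_Julia_eq_survivors[OF assms(1,3)])
    interpret block_maps N "\<lambda>j. c (K + j)" by (rule K(2))
    have "\<exists>k\<ge>k0. cmod (c (K + k)) \<ge> B" for B k0
    proof (rule ccontr)
      assume neg: "\<not> ?thesis"
      have "cmod (c k) \<le> B" if "k \<ge> K + k0" for k
      proof -
        have "k - K \<ge> k0" "K + (k - K) = k" using that by auto
        then show ?thesis using neg by (metis linear)
      qed
      then have "bounded (c ` {K + k0..})" by (auto simp: bounded_iff)
      then have "bounded (c ` ({..<K + k0} \<union> {K + k0..}))"
        by (simp add: image_Un finite_imp_bounded)
      then have "bounded (c ` {1..})" by (rule bounded_subset) auto
      with unbdd show False by contradiction
    qed
    then have "pointwise_thin (survivors 0)" by (rule survivors_pointwise_thin)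
    then show ?thesis
      unfolding K(3) in_plane_image_iff using pointwise_thin_imp_HNUP compact_survivors by blast
  qed
  have "\<not> (in_plane uniformly_perfect S \<and> in_plane ?thin S)" for S
  proof
    assume "in_plane uniformly_perfect S \<and> in_plane ?thin S"
    then obtain F where "S = Plane ` F" "uniformly_perfect F" "in_plane ?thin S"
      unfolding in_plane_def by blast
    then have "uniformly_perfect F" "HNUP F" by (simp_all add: in_plane_image_iff)
    then show False by (simp add: HNUP_def)
  qed
  with up thin show ?thesis by blast
qed

end
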